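(* Let $H\subseteq \operatorname{GL}_2(\hat{\mathbb{Z}})$ be a closed subgroup. Then $H=\operatorname{GL}_2(\hat{\mathbb{Z}})$ if and only if (i) $\pi_\ell(H)=\operatorname{GL}_2(\mathbb{Z}_\ell)$ for every prime $\ell$, and (ii) the map $(\operatorname{sgn},\det)\colon H\rightarrow \{\pm 1\}\times\hat{\mathbb{Z}}^{*}$ is surjective.
   Context: $\hat{\mathbb{Z}}=\varprojlim \mathbb{Z}/m\mathbb{Z}\simeq\prod_{\ell \text{ prime}}\mathbb{Z}_\ell$, so $\operatorname{GL}_2(\hat{\mathbb{Z}})\simeq\prod_{\ell}\operatorname{GL}_2(\mathbb{Z}_\ell)$ (a profinite group); $\pi_\ell\colon \operatorname{GL}_2(\hat{\mathbb{Z}})\to\operatorname{GL}_2(\mathbb{Z}_\ell)$ is the projection. The map $\operatorname{sgn}\colon\operatorname{GL}_2(\hat{\mathbb{Z}})\to\{\pm1\}$ is defined as the composition of reduction modulo $2$, $\operatorname{GL}_2(\hat{\mathbb{Z}})\to\operatorname{GL}_2(\mathbb{F}_2)$, with the identification $\operatorname{GL}_2(\mathbb{F}_2)\simeq\mathfrak{S}_3$ (matrices acting as permutations of the three nonzero vectors of $\mathbb{F}_2^2$), followed by the sign of a permutation. $\det$ is the determinant $\operatorname{GL}_2(\hat{\mathbb{Z}})\to\hat{\mathbb{Z}}^*$. *)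

theory Defs
  imports
    "HOL-Analysis.Analysis"
    "HOL-Number_Theory.Number_Theory"
    "HOL-Combinatorics.Permutations"
begin

section \<open>Inverse limits of the rings of integers modulo \<open>m\<close>\<close>

text \<open>
  For a set \<open>D\<close> of moduli \<open>m > 1\<close>, the inverse limit of the rings \<open>residue_ring m\<close> with
  \<open>m \<in> D\<close> along the reductions \<open>a \<mapsto> a mod m\<close> (for \<open>m dvd n\<close>), realised as the ring of
  compatible families in the product. Residue classes modulo \<open>m\<close> are represented by
  \<open>{0..m - 1}\<close>. The modulus \<open>1\<close> has to be avoided because \<open>residue_ring 1\<close> is not a ring
  (its unit, 1, is not in its carrier); as the true quotient is zero, omitting it does not
  change the limit.
\<close>

definition residue_lim :: "int set \<Rightarrow> (int \<Rightarrow> int) ring" where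
  "residue_lim D =
    \<lparr>carrier = {x \<in> \<Pi>\<^sub>E m\<in>D. carrier (residue_ring m).
                 \<forall>m\<in>D. \<forall>n\<in>D. m dvd n \<longrightarrow> x n mod m = x m},
     monoid.mult = (\<lambda>x y. \<lambda>m\<in>D. x m \<otimes>\<^bsub>residue_ring m\<^esub> y m),
     one = (\<lambda>m\<in>D. \<one>\<^bsub>residue_ring m\<^esub>),
     zero = (\<lambda>m\<in>D. \<zero>\<^bsub>residue_ring m\<^esub>),
     add = (\<lambda>x y. \<lambda>m\<in>D. x m \<oplus>\<^bsub>residue_ring m\<^esub> y m)\<rparr>"

definition residue_lim_topology :: "int set \<Rightarrow> (int \<Rightarrow> int) topology" where
  "residue_lim_topology D =
    subtopology (product_topology (\<lambda>m. discrete_topology (carrier (residue_ring m))) D)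
      (carrier (residue_lim D))"

definition Zhat :: "(int \<Rightarrow> int) ring" where
  "Zhat = residue_lim {m. m > 1}"

definition Zhat_topology :: "(int \<Rightarrow> int) topology" where
  "Zhat_topology = residue_lim_topology {m. m > 1}"

definition prime_powers :: "nat \<Rightarrow> int set" where
  "prime_powers l = {int l ^ n | n. n \<ge> 1}"

definition Zadic :: "nat \<Rightarrow> (int \<Rightarrow> int) ring" where
  "Zadic l = residue_lim (prime_powers l)"

section \<open>Two by two matrices over a ring\<close>

text \<open>The tuple \<open>(a, b, c, d)\<close> stands for the matrix with rows \<open>(a, b)\<close> and \<open>(c, d)\<close>.\<close>

type_synonym 'a mat2 = "'a \<times> 'a \<times> 'a \<times> 'a"

definition map_mat2 :: "('a \<Rightarrow> 'b) \<Rightarrow> 'a mat2 \<Rightarrow> 'b mat2" where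
  "map_mat2 f = (\<lambda>(a, b, c, d). (f a, f b, f c, f d))"

definition M2 :: "('a, 'e) ring_scheme \<Rightarrow> 'a mat2 monoid" where
  "M2 R =
    \<lparr>carrier = carrier R \<times> carrier R \<times> carrier R \<times> carrier R,
     monoid.mult = (\<lambda>(a, b, c, d) (a', b', c', d').
       (a \<otimes>\<^bsub>R\<^esub> a' \<oplus>\<^bsub>R\<^esub> b \<otimes>\<^bsub>R\<^esub> c', a \<otimes>\<^bsub>R\<^esub> b' \<oplus>\<^bsub>R\<^esub> b \<otimes>\<^bsub>R\<^esub> d',
        c \<otimes>\<^bsub>R\<^esub> a' \<oplus>\<^bsub>R\<^esub> d \<otimes>\<^bsub>R\<^esub> c', c \<otimes>\<^bsub>R\<^esub> b' \<oplus>\<^bsub>R\<^esub> d \<otimes>\<^bsub>R\<^esub> d')),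
     one = (\<one>\<^bsub>R\<^esub>, \<zero>\<^bsub>R\<^esub>, \<zero>\<^bsub>R\<^esub>, \<one>\<^bsub>R\<^esub>)\<rparr>"

definition GL2 :: "('a, 'e) ring_scheme \<Rightarrow> 'a mat2 monoid" where
  "GL2 R = units_of (M2 R)"

definition det2 :: "('a, 'e) ring_scheme \<Rightarrow> 'a mat2 \<Rightarrow> 'a" where
  "det2 R = (\<lambda>(a, b, c, d). a \<otimes>\<^bsub>R\<^esub> d \<ominus>\<^bsub>R\<^esub> b \<otimes>\<^bsub>R\<^esub> c)"

definition mat2_act :: "('a, 'e) ring_scheme \<Rightarrow> 'a mat2 \<Rightarrow> 'a \<times> 'a \<Rightarrow> 'a \<times> 'a" where
  "mat2_act R = (\<lambda>(a, b, c, d) (u, v).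
     (a \<otimes>\<^bsub>R\<^esub> u \<oplus>\<^bsub>R\<^esub> b \<otimes>\<^bsub>R\<^esub> v, c \<otimes>\<^bsub>R\<^esub> u \<oplus>\<^bsub>R\<^esub> d \<otimes>\<^bsub>R\<^esub> v))"

section \<open>The profinite group \<open>GL2 Zhat\<close>\<close>

text \<open>
  The profinite topology, as the subspace topology from the space of all matrices over \<open>Zhat\<close>.
  It is the topology of the inverse limit of the finite discrete groups
  \<open>GL2 (residue_ring m)\<close>: both are induced by the entrywise reductions modulo all \<open>m\<close>.
\<close>

definition GL2_Zhat_topology :: "(int \<Rightarrow> int) mat2 topology" where
  "GL2_Zhat_topology =
    subtopology
      (prod_topology Zhat_topology
        (prod_topology Zhat_topology (prod_topology Zhat_topology Zhat_topology)))
      (carrier (GL2 Zhat))"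

text \<open>
  The projection \<open>Zhat \<rightarrow> Zadic l\<close> of the decomposition of \<open>Zhat\<close> as a product over all primes
  forgets the components at the moduli that are not powers of \<open>l\<close>.
\<close>

definition proj_GL2 :: "nat \<Rightarrow> (int \<Rightarrow> int) mat2 \<Rightarrow> (int \<Rightarrow> int) mat2" where
  "proj_GL2 l = map_mat2 (\<lambda>x. restrict x (prime_powers l))"

definition sgn_GL2 :: "(int \<Rightarrow> int) mat2 \<Rightarrow> int" where
  "sgn_GL2 g =
    (let F2 = residue_ring 2 in
      sign_on (carrier F2 \<times> carrier F2 - {(\<zero>\<^bsub>F2\<^esub>, \<zero>\<^bsub>F2\<^esub>)})
        (mat2_act F2 (map_mat2 (\<lambda>x. x 2) g)))"

end

theory Submission
  imports Defs
begin

text \<open>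
  A closed subgroup is determined by its images modulo all \<open>m\<close>, so it suffices to show that \<open>H\<close>
  surjects onto \<open>GL2 (\<int>/m)\<close>. By (i) this holds for prime powers. For odd \<open>m\<close> and a prime power
  \<open>q = l\<^sup>k\<close> prime to \<open>m\<close>, Goursat's lemma reduces surjectivity modulo \<open>m q\<close> to showing that
  \<open>N\<close>, the image modulo \<open>q\<close> of the elements of \<open>H\<close> that are trivial modulo \<open>m\<close>, is everything.
  As \<open>SL2 (\<int>/m)\<close> is perfect, condition (ii) provides elements of \<open>N\<close> with any prescribed
  determinant and sign.

  A normal subgroup \<open>N\<close> of \<open>GL2 (\<int>/q)\<close> with this property is everything. Conjugate
  \<open>n \<in> N\<close>, not scalar modulo \<open>l\<close>, to a matrix with zero top left entry; then conjugation by \<open>n\<close>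
  maps upper to lower unipotent matrices, so the images of both unipotent subgroups modulo \<open>N\<close>
  agree. They then contain the Weyl element, which gives a second identification of the two. For odd
  \<open>l\<close> these identifications differ if \<open>det n\<close> is a quadratic nonresidue, and the unipotent
  subgroups die modulo \<open>N\<close>. For \<open>l = 2\<close> take \<open>n\<close> of determinant 1 and sign -1: it is conjugate to a
  product of two unipotent matrices, and this relation kills the unipotent subgroups.
\<close>

section \<open>Two by two matrices over commutative rings\<close>

lemma carrier_M2: "carrier (M2 R) = carrier R \<times> carrier R \<times> carrier R \<times> carrier R"
  by (simp add: M2_def)

lemma mult_M2:
  "(a, b, c, d) \<otimes>\<^bsub>M2 R\<^esub> (a', b', c', d') =
    (a \<otimes>\<^bsub>R\<^esub> a' \<oplus>\<^bsub>R\<^esub> b \<otimes>\<^bsub>R\<^esub> c', a \<otimes>\<^bsub>R\<^esub> b' \<oplus>\<^bsub>R\<^esub> b \<otimes>\<^bsub>R\<^esub> d',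
     c \<otimes>\<^bsub>R\<^esub> a' \<oplus>\<^bsub>R\<^esub> d \<otimes>\<^bsub>R\<^esub> c', c \<otimes>\<^bsub>R\<^esub> b' \<oplus>\<^bsub>R\<^esub> d \<otimes>\<^bsub>R\<^esub> d')"
  by (simp add: M2_def)

lemma one_M2: "\<one>\<^bsub>M2 R\<^esub> = (\<one>\<^bsub>R\<^esub>, \<zero>\<^bsub>R\<^esub>, \<zero>\<^bsub>R\<^esub>, \<one>\<^bsub>R\<^esub>)"
  by (simp add: M2_def)

lemma carrier_GL2: "carrier (GL2 R) = Units (M2 R)"
  by (simp add: GL2_def units_of_def)

lemma mult_GL2: "mult (GL2 R) = mult (M2 R)"
  by (simp add: GL2_def units_of_def)

lemma one_GL2: "\<one>\<^bsub>GL2 R\<^esub> = \<one>\<^bsub>M2 R\<^esub>"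
  by (simp add: GL2_def units_of_def)

lemma det2_mat2: "det2 R (a, b, c, d) = a \<otimes>\<^bsub>R\<^esub> d \<ominus>\<^bsub>R\<^esub> b \<otimes>\<^bsub>R\<^esub> c"
  by (simp add: det2_def)

lemma map_mat2_mat2: "map_mat2 f (a, b, c, d) = (f a, f b, f c, f d)"
  by (simp add: map_mat2_def)

lemma (in comm_monoid) Units_if_r_inv:
  assumes "a \<in> carrier G" "b \<in> carrier G" "a \<otimes> b = \<one>"
  shows "a \<in> Units G"
  using assms m_comm by (auto simp: Units_def intro!: bexI [of _ b])

context cring
begin

lemma monoid_M2: "monoid (M2 R)"
proof (rule monoidI)
  fix x y z
  assume "x \<in> carrier (M2 R)" "y \<in> carrier (M2 R)" "z \<in> carrier (M2 R)"
  then show "x \<otimes>\<^bsub>M2 R\<^esub> y \<otimes>\<^bsub>M2 R\<^esub> z = x \<otimes>\<^bsub>M2 R\<^esub> (y \<otimes>\<^bsub>M2 R\<^esub> z)"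
    by (cases x, cases y, cases z)
      (simp add: carrier_M2 mult_M2 l_distr r_distr m_assoc a_ac)
next
  fix x y
  assume "x \<in> carrier (M2 R)" "y \<in> carrier (M2 R)"
  then show "x \<otimes>\<^bsub>M2 R\<^esub> y \<in> carrier (M2 R)"
    by (cases x, cases y) (simp add: carrier_M2 mult_M2)
qed (auto simp: carrier_M2 mult_M2 one_M2)

lemma group_GL2: "group (GL2 R)"
  unfolding GL2_def by (rule monoid.units_group [OF monoid_M2])

lemma det2_closed: "x \<in> carrier (M2 R) \<Longrightarrow> det2 R x \<in> carrier R"
  by (cases x) (simp add: carrier_M2 det2_mat2)

lemma det2_one: "det2 R \<one>\<^bsub>M2 R\<^esub> = \<one>"
  by (simp add: one_M2 det2_mat2 minus_eq)

lemma det2_mult: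
  assumes "x \<in> carrier (M2 R)" "y \<in> carrier (M2 R)"
  shows "det2 R (x \<otimes>\<^bsub>M2 R\<^esub> y) = det2 R x \<otimes> det2 R y"
proof -
  obtain a b c d where x: "x = (a, b, c, d)" by (cases x)
  obtain a' b' c' d' where y: "y = (a', b', c', d')" by (cases y)
  have "a \<in> carrier R" "b \<in> carrier R" "c \<in> carrier R" "d \<in> carrier R"
    "a' \<in> carrier R" "b' \<in> carrier R" "c' \<in> carrier R" "d' \<in> carrier R"
    using assms by (auto simp: x y carrier_M2)
  then show ?thesis
    unfolding x y mult_M2 det2_mat2 by algebra
qed

lemma Units_M2_iff: "x \<in> Units (M2 R) \<longleftrightarrow> x \<in> carrier (M2 R) \<and> det2 R x \<in> Units R"
proof
  assume "x \<in> Units (M2 R)"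
  then obtain y where "x \<in> carrier (M2 R)" "y \<in> carrier (M2 R)"
    "x \<otimes>\<^bsub>M2 R\<^esub> y = \<one>\<^bsub>M2 R\<^esub>"
    by (auto simp: Units_def)
  moreover from this have "det2 R x \<otimes> det2 R y = \<one>"
    by (metis det2_mult det2_one)
  ultimately show "x \<in> carrier (M2 R) \<and> det2 R x \<in> Units R"
    by (metis Units_if_r_inv det2_closed)
next
  assume *: "x \<in> carrier (M2 R) \<and> det2 R x \<in> Units R"
  obtain a b c d where x: "x = (a, b, c, d)" by (cases x)
  define u where "u = inv (det2 R x)"
  have car: "a \<in> carrier R" "b \<in> carrier R" "c \<in> carrier R" "d \<in> carrier R" "u \<in> carrier R"
    using * by (auto simp: x carrier_M2 u_def)
  \<comment> \<open>The adjugate divided by the determinant.\<close>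
  define y where "y = (u \<otimes> d, \<ominus> (u \<otimes> b), \<ominus> (u \<otimes> c), u \<otimes> a)"
  have "u \<otimes> (a \<otimes> d \<ominus> b \<otimes> c) = \<one>"
    using * Units_l_inv unfolding u_def by (simp add: x det2_mat2)
  moreover have "a \<otimes> (u \<otimes> d) \<oplus> b \<otimes> (\<ominus> (u \<otimes> c)) = u \<otimes> (a \<otimes> d \<ominus> b \<otimes> c)"
    using car by algebra
  moreover have "a \<otimes> (\<ominus> (u \<otimes> b)) \<oplus> b \<otimes> (u \<otimes> a) = \<zero>"
    using car by algebra
  moreover have "c \<otimes> (u \<otimes> d) \<oplus> d \<otimes> (\<ominus> (u \<otimes> c)) = \<zero>"
    using car by algebra
  moreover have "c \<otimes> (\<ominus> (u \<otimes> b)) \<oplus> d \<otimes> (u \<otimes> a) = u \<otimes> (a \<otimes> d \<ominus> b \<otimes> c)"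
    using car by algebra
  moreover have "(u \<otimes> d) \<otimes> a \<oplus> (\<ominus> (u \<otimes> b)) \<otimes> c = u \<otimes> (a \<otimes> d \<ominus> b \<otimes> c)"
    using car by algebra
  moreover have "(u \<otimes> d) \<otimes> b \<oplus> (\<ominus> (u \<otimes> b)) \<otimes> d = \<zero>"
    using car by algebra
  moreover have "(\<ominus> (u \<otimes> c)) \<otimes> a \<oplus> (u \<otimes> a) \<otimes> c = \<zero>"
    using car by algebra
  moreover have "(\<ominus> (u \<otimes> c)) \<otimes> b \<oplus> (u \<otimes> a) \<otimes> d = u \<otimes> (a \<otimes> d \<ominus> b \<otimes> c)"
    using car by algebra
  ultimately have "x \<otimes>\<^bsub>M2 R\<^esub> y = \<one>\<^bsub>M2 R\<^esub>" "y \<otimes>\<^bsub>M2 R\<^esub> x = \<one>\<^bsub>M2 R\<^esub>"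
    unfolding x y_def mult_M2 one_M2 by simp_all
  moreover have "x \<in> carrier (M2 R)" "y \<in> carrier (M2 R)"
    using car by (auto simp: x y_def carrier_M2)
  ultimately show "x \<in> Units (M2 R)"
    by (auto simp: Units_def)
qed

lemma carrier_GL2_iff: "x \<in> carrier (GL2 R) \<longleftrightarrow> x \<in> carrier (M2 R) \<and> det2 R x \<in> Units R"
  by (simp add: carrier_GL2 Units_M2_iff)

end

context ring_hom_cring
begin

lemma det2_map_mat2:
  assumes "x \<in> carrier (M2 R)"
  shows "det2 S (map_mat2 h x) = h (det2 R x)"
  using assms by (cases x) (simp add: carrier_M2 det2_mat2 map_mat2_mat2 R.minus_eq S.minus_eq)

lemma map_mat2_hom: "map_mat2 h \<in> hom (M2 R) (M2 S)"
  by (rule homI) (auto simp: carrier_M2 mult_M2 map_mat2_mat2)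

lemma Units_hom: "u \<in> Units R \<Longrightarrow> h u \<in> Units S"
  by (metis R.Units_closed R.Units_inv_closed R.Units_r_inv S.Units_if_r_inv
      hom_closed hom_mult hom_one)

lemma map_mat2_hom_GL2: "map_mat2 h \<in> hom (GL2 R) (GL2 S)"
proof (rule homI)
  fix x
  assume "x \<in> carrier (GL2 R)"
  then have x: "x \<in> carrier (M2 R)" "det2 R x \<in> Units R"
    by (simp_all add: R.carrier_GL2_iff)
  then have "map_mat2 h x \<in> carrier (M2 S)"
    using map_mat2_hom by (auto dest: hom_in_carrier)
  with x show "map_mat2 h x \<in> carrier (GL2 S)"
    by (simp add: S.carrier_GL2_iff det2_map_mat2 Units_hom)
next
  fix x y
  assume "x \<in> carrier (GL2 R)" "y \<in> carrier (GL2 R)"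
  then show "map_mat2 h (x \<otimes>\<^bsub>GL2 R\<^esub> y) = map_mat2 h x \<otimes>\<^bsub>GL2 S\<^esub> map_mat2 h y"
    using Group.hom_mult [OF map_mat2_hom] by (auto simp: mult_GL2 R.carrier_GL2_iff)
qed

lemma group_hom_GL2: "group_hom (GL2 R) (GL2 S) (map_mat2 h)"
  using map_mat2_hom_GL2 R.group_GL2 S.group_GL2
  by (simp add: group_hom_def group_hom_axioms_def)

end

section \<open>Integer matrices modulo \<open>m\<close>\<close>

text \<open>Matrices modulo \<open>m\<close> are represented by arbitrary integer matrices, so that
  identities between them become divisibilities of integer polynomials.\<close>

definition mat_mod :: "int \<Rightarrow> int mat2 \<Rightarrow> int mat2" where
  "mat_mod m = map_mat2 (\<lambda>x. x mod m)"

lemma mat_mod_eq_iff: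
  "mat_mod m (a, b, c, d) = mat_mod m (a', b', c', d') \<longleftrightarrow>
    [a = a'] (mod m) \<and> [b = b'] (mod m) \<and> [c = c'] (mod m) \<and> [d = d'] (mod m)"
  by (simp add: mat_mod_def map_mat2_def cong_def)

lemma mat_mod_eqI:
  assumes "m dvd a - a'" "m dvd b - b'" "m dvd c - c'" "m dvd d - d'"
  shows "mat_mod m (a, b, c, d) = mat_mod m (a', b', c', d')"
  using assms by (simp add: mat_mod_eq_iff cong_iff_dvd_diff)

lemma residue_ring_ops:
  "carrier (residue_ring m) = {0..m - 1}" "\<zero>\<^bsub>residue_ring m\<^esub> = 0" "\<one>\<^bsub>residue_ring m\<^esub> = 1"
  "x \<otimes>\<^bsub>residue_ring m\<^esub> y = (x * y) mod m" "x \<oplus>\<^bsub>residue_ring m\<^esub> y = (x + y) mod m"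
  by (simp_all add: residue_ring_def)

lemma mat_mod_mult:
  "mat_mod m (a, b, c, d) \<otimes>\<^bsub>GL2 (residue_ring m)\<^esub> mat_mod m (a', b', c', d') =
    mat_mod m (a * a' + b * c', a * b' + b * d', c * a' + d * c', c * b' + d * d')"
  by (simp add: mat_mod_def map_mat2_def mult_GL2 mult_M2 residue_ring_ops mod_simps)

lemma det2_mat_mod:
  assumes "m > 1"
  shows "det2 (residue_ring m) (mat_mod m (a, b, c, d)) = (a * d - b * c) mod m"
proof -
  interpret residues m "residue_ring m" by unfold_locales (use assms in simp_all)
  show ?thesis
    by (simp add: mat_mod_def map_mat2_def det2_mat2 minus_eq res_neg_eq residue_ring_ops mod_simps)
qed

lemma mat_mod_one: "m > 1 \<Longrightarrow> \<one>\<^bsub>GL2 (residue_ring m)\<^esub> = mat_mod m (1, 0, 0, 1)"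
  by (simp add: mat_mod_def map_mat2_def one_GL2 one_M2 residue_ring_ops)

lemma mod_in_Units_residue_ring:
  assumes "m > 1"
  shows "x mod m \<in> Units (residue_ring m) \<longleftrightarrow> coprime x m"
proof -
  interpret residues m "residue_ring m" by unfold_locales (use assms in simp_all)
  show ?thesis
  proof -
    have "x mod m \<noteq> 0" if "coprime x m"
      using that assms coprime_common_divisor [of x m m] by (auto simp: mod_eq_0_iff_dvd)
    moreover have "0 \<le> x mod m" "x mod m < m" "m \<noteq> 0"
      using assms by simp_all
    ultimately show ?thesis
      by (auto simp: res_units_eq)
  qed
qed

lemma mat_mod_in_carrier_iff:
  assumes "m > 1"
  shows "mat_mod m (a, b, c, d) \<in> carrier (GL2 (residue_ring m)) \<longleftrightarrow> coprime (a * d - b * c) m"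
proof -
  interpret residues m "residue_ring m" by unfold_locales (use assms in simp_all)
  have "mat_mod m (a, b, c, d) \<in> carrier (M2 (residue_ring m))"
    using assms by (auto simp: mat_mod_def map_mat2_def carrier_M2 residue_ring_ops)
  then show ?thesis
    using assms by (simp add: carrier_GL2_iff det2_mat_mod mod_in_Units_residue_ring)
qed

lemma GL2_residue_cases:
  assumes "m > 1" "x \<in> carrier (GL2 (residue_ring m))"
  obtains a b c d where "x = mat_mod m (a, b, c, d)" "coprime (a * d - b * c) m"
proof -
  interpret residues m "residue_ring m" by unfold_locales (use assms in simp_all)
  obtain a b c d where x: "x = (a, b, c, d)" by (cases x)
  have "x \<in> carrier (M2 (residue_ring m))"
    using assms by (simp add: carrier_GL2_iff)
  then have "x = mat_mod m (a, b, c, d)"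
    by (auto simp: x mat_mod_def map_mat2_def carrier_M2 residue_ring_ops)
  with that assms mat_mod_in_carrier_iff show ?thesis by metis
qed

lemma group_GL2_residue: "m > 1 \<Longrightarrow> group (GL2 (residue_ring m))"
  using cring.group_GL2 residues.cring [of m] by (simp add: residues_def)

section \<open>Elementary matrices and the generation of \<open>SL2\<close> modulo
  \<open>m\<close>\<close>

definition elem_up :: "int \<Rightarrow> int \<Rightarrow> int mat2" where
  "elem_up m x = mat_mod m (1, x, 0, 1)"

definition elem_lo :: "int \<Rightarrow> int \<Rightarrow> int mat2" where
  "elem_lo m x = mat_mod m (1, 0, x, 1)"

lemma elem_closed:
  assumes "m > 1"
  shows "elem_up m x \<in> carrier (GL2 (residue_ring m))" "elem_lo m x \<in> carrier (GL2 (residue_ring m))"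
  using assms by (simp_all add: elem_up_def elem_lo_def mat_mod_in_carrier_iff)

text \<open>The parameter runs over all integers, so each family is a homomorphism from the additive
  group of integers; \<open>unipotent_relation\<close> takes its inputs in this form.\<close>

lemma elem_add:
  "elem_up m x \<otimes>\<^bsub>GL2 (residue_ring m)\<^esub> elem_up m y = elem_up m (x + y)"
  "elem_lo m x \<otimes>\<^bsub>GL2 (residue_ring m)\<^esub> elem_lo m y = elem_lo m (x + y)"
  by (simp_all add: elem_up_def elem_lo_def mat_mod_mult add.commute)

lemma elem_cong:
  assumes "[x = y] (mod m)"
  shows "elem_up m x = elem_up m y" "elem_lo m x = elem_lo m y"
  using assms by (simp_all add: elem_up_def elem_lo_def mat_mod_eq_iff)

lemma cong_inverse_int:
  fixes a m :: int
  assumes "coprime a m"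
  obtains a' where "[a * a' = 1] (mod m)"
  using cong_solve_coprime_int [OF assms] by blast

text \<open>The rings of integers modulo \<open>m\<close> have stable rank 1.\<close>

lemma coprime_add_mult:
  fixes r p m :: int
  assumes "m \<noteq> 0" "\<And>q. prime q \<Longrightarrow> q dvd m \<Longrightarrow> q dvd r \<Longrightarrow> \<not> q dvd p"
  obtains y where "coprime (r + y * p) m"
proof
  \<comment> \<open>With \<open>y = \<Prod>Q\<close>, each prime divisor of \<open>m\<close> divides
    exactly one of \<open>r\<close> and \<open>y * p\<close>, hence never their sum.\<close>
  define Q where "Q = {q \<in> prime_factors m. \<not> q dvd r}"
  have Q: "q dvd \<Prod>Q \<longleftrightarrow> \<not> q dvd r" if q: "prime q" "q dvd m" for q
  proof
    assume "q dvd \<Prod>Q"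
    moreover have "finite Q" by (simp add: Q_def)
    ultimately obtain q' where "q' \<in> Q" "q dvd q'"
      using q by (auto simp: prime_dvd_prod_iff)
    moreover have "q' = q"
      using \<open>q' \<in> Q\<close> \<open>q dvd q'\<close> q primes_dvd_imp_eq by (auto simp: Q_def in_prime_factors_iff)
    ultimately show "\<not> q dvd r" by (simp add: Q_def)
  next
    assume "\<not> q dvd r"
    then show "q dvd \<Prod>Q"
      using q assms by (intro dvd_prodI) (auto simp: Q_def in_prime_factors_iff)
  qed
  show "coprime (r + \<Prod>Q * p) m"
  proof (rule ccontr)
    assume "\<not> coprime (r + \<Prod>Q * p) m"
    then obtain q where q: "prime q" "q dvd r + \<Prod>Q * p" "q dvd m"
      using assms(1) prime_divisor_exists [of "gcd (r + \<Prod>Q * p) m"]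
      by (auto simp: coprime_iff_gcd_eq_1)
    show False
    proof (cases "q dvd r")
      case True
      then show False
        using q Q assms(2) by (metis dvd_add_right_iff prime_dvd_mult_iff)
    next
      case False
      then show False
        using q Q by (metis dvd_add_left_iff dvd_mult2)
    qed
  qed
qed

text \<open>If the lower left entry is a unit, three elementary matrices suffice. Stable rank 1
  makes it a unit after a multiple of the first row is added to the second.\<close>

lemma elementary_imp_SL2:
  assumes "m > 1" and S: "subgroup S (GL2 (residue_ring m))"
    and up: "\<And>x. elem_up m x \<in> S" and lo: "\<And>x. elem_lo m x \<in> S"
    and g: "g \<in> carrier (GL2 (residue_ring m))" "det2 (residue_ring m) g = 1"
  shows "g \<in> S"
proof -
  let ?G = "GL2 (residue_ring m)"
  interpret group ?G by (rule group_GL2_residue) fact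
  have unit: "mat_mod m (p, q, r, s) \<in> S"
    if "m dvd p * s - q * r - 1" "coprime r m" for p q r s
  proof -
    obtain r' where r': "[r * r' = 1] (mod m)"
      using cong_inverse_int \<open>coprime r m\<close> by blast
    \<comment> \<open>The upper right entry of the product of three elementary matrices below is
      forced by the determinant: its difference to \<open>q\<close> is a combination of
      \<open>r * r' - 1\<close> and \<open>p * s - q * r - 1\<close>.\<close>
    have "q - (((1 + (p - 1) * r' * r) * ((s - 1) * r')) + (p - 1) * r') =
        - ((p - 1) * (s - 1) * r' * (r * r' - 1) + r' * (p * s - q * r - 1) + q * (r * r' - 1))"
      by (simp add: algebra_simps)
    then have tr: "m dvd q - (((1 + (p - 1) * r' * r) * ((s - 1) * r')) + (p - 1) * r')"
      using that(1) r' by (simp only: dvd_minus_iff cong_iff_dvd_diff dvd_add dvd_mult)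
    have "mat_mod m (p, q, r, s) =
        elem_up m ((p - 1) * r') \<otimes>\<^bsub>?G\<^esub> elem_lo m r \<otimes>\<^bsub>?G\<^esub> elem_up m ((s - 1) * r')"
      unfolding elem_up_def elem_lo_def mat_mod_mult
      by (rule mat_mod_eqI; (simp add: tr; fail | use r' [unfolded cong_iff_dvd_diff] in Groebner_Basis.algebra))
    also have "\<dots> \<in> S"
      using up lo S by (simp add: subgroup.m_closed)
    finally show ?thesis .
  qed
  obtain p q r s where g': "g = mat_mod m (p, q, r, s)"
    by (rule GL2_residue_cases [OF assms(1) g(1)])
  have det: "m dvd p * s - q * r - 1"
    using g \<open>m > 1\<close> by (simp add: g' det2_mat_mod mod_eq_dvd_iff [symmetric])
  have "\<not> a dvd p" if "prime a" "a dvd m" "a dvd r" for a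
  proof
    assume "a dvd p"
    with that have "a dvd p * s - q * r" by simp
    moreover have "a dvd p * s - q * r - 1"
      using det \<open>a dvd m\<close> dvd_trans by blast
    ultimately have "a dvd 1" by (metis dvd_diff_right_iff)
    with \<open>prime a\<close> show False
      using not_prime_unit by blast
  qed
  then obtain y where "coprime (r + y * p) m"
    using coprime_add_mult [of m r p] \<open>m > 1\<close> by auto
  moreover have "m dvd p * (s + y * q) - q * (r + y * p) - 1"
    using det by (simp add: algebra_simps)
  ultimately have "mat_mod m (p, q, r + y * p, s + y * q) \<in> S"
    by (rule unit [rotated])
  moreover have "g = elem_lo m (- y) \<otimes>\<^bsub>?G\<^esub> mat_mod m (p, q, r + y * p, s + y * q)"
    by (simp add: g' elem_lo_def mat_mod_mult)
  ultimately show ?thesis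
    using lo S by (simp add: subgroup.m_closed)
qed

text \<open>Conjugation by diag(2, 1), invertible because \<open>m\<close> is odd, doubles the
  parameter of \<open>elem_up\<close>, so the commutator is \<open>elem_up m x\<close> itself;
  diag(1, 2) does the same for \<open>elem_lo\<close>. Taking the factors from \<open>GL2\<close>
  also covers \<open>m\<close> divisible by 3, where \<open>SL2\<close> modulo \<open>m\<close> is
  not perfect. The equations are commutators with the inverses cleared.\<close>

lemma elementary_commutator:
  assumes "m > 1" "odd m"
  shows "\<exists>g\<in>carrier (GL2 (residue_ring m)). \<exists>h\<in>carrier (GL2 (residue_ring m)).
           g \<otimes>\<^bsub>GL2 (residue_ring m)\<^esub> h = elem_up m x \<otimes>\<^bsub>GL2 (residue_ring m)\<^esub> (h \<otimes>\<^bsub>GL2 (residue_ring m)\<^esub> g)"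
    "\<exists>g\<in>carrier (GL2 (residue_ring m)). \<exists>h\<in>carrier (GL2 (residue_ring m)).
           g \<otimes>\<^bsub>GL2 (residue_ring m)\<^esub> h = elem_lo m x \<otimes>\<^bsub>GL2 (residue_ring m)\<^esub> (h \<otimes>\<^bsub>GL2 (residue_ring m)\<^esub> g)"
proof -
  have "mat_mod m (2, 0, 0, 1) \<in> carrier (GL2 (residue_ring m))"
    "mat_mod m (1, 0, 0, 2) \<in> carrier (GL2 (residue_ring m))"
    using assms by (simp_all add: mat_mod_in_carrier_iff)
  moreover have "mat_mod m (2, 0, 0, 1) \<otimes>\<^bsub>GL2 (residue_ring m)\<^esub> elem_up m x =
      elem_up m x \<otimes>\<^bsub>GL2 (residue_ring m)\<^esub> (elem_up m x \<otimes>\<^bsub>GL2 (residue_ring m)\<^esub> mat_mod m (2, 0, 0, 1))"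
    "mat_mod m (1, 0, 0, 2) \<otimes>\<^bsub>GL2 (residue_ring m)\<^esub> elem_lo m x =
      elem_lo m x \<otimes>\<^bsub>GL2 (residue_ring m)\<^esub> (elem_lo m x \<otimes>\<^bsub>GL2 (residue_ring m)\<^esub> mat_mod m (1, 0, 0, 2))"
    by (simp_all add: elem_up_def elem_lo_def mat_mod_mult)
  ultimately show
    "\<exists>g\<in>carrier (GL2 (residue_ring m)). \<exists>h\<in>carrier (GL2 (residue_ring m)).
           g \<otimes>\<^bsub>GL2 (residue_ring m)\<^esub> h = elem_up m x \<otimes>\<^bsub>GL2 (residue_ring m)\<^esub> (h \<otimes>\<^bsub>GL2 (residue_ring m)\<^esub> g)"
    "\<exists>g\<in>carrier (GL2 (residue_ring m)). \<exists>h\<in>carrier (GL2 (residue_ring m)).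
           g \<otimes>\<^bsub>GL2 (residue_ring m)\<^esub> h = elem_lo m x \<otimes>\<^bsub>GL2 (residue_ring m)\<^esub> (h \<otimes>\<^bsub>GL2 (residue_ring m)\<^esub> g)"
    using elem_closed [OF \<open>m > 1\<close>] by blast+
qed

section \<open>Normal subgroups modulo prime powers\<close>

lemma (in group) additive_zero:
  fixes E :: "int \<Rightarrow> 'a"
  assumes "\<And>x. E x \<in> carrier G" "\<And>x y. E (x + y) = E x \<otimes> E y"
  shows "E 0 = \<one>"
  using assms(2) [of 0 0] assms(1) [of 0] by simp

text \<open>
  In \<open>SL2\<close> the Weyl element \<open>w = E 1 \<otimes> F (-1) \<otimes> E 1\<close> swaps the two unipotent subgroups. If
  these have the same image in a quotient, then so does \<open>w\<close>, and conjugation by \<open>w\<close> becomes trivial on it.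
\<close>

lemma (in group) unipotent_relation:
  fixes E F :: "int \<Rightarrow> 'a"
  assumes E: "\<And>x. E x \<in> carrier G" "\<And>x y. E (x + y) = E x \<otimes> E y"
    and F: "\<And>x. F x \<in> carrier G" "\<And>x y. F (x + y) = F x \<otimes> F y"
    and EF: "\<And>x. E x = F (z * x)" and z': "F (z * z') = F 1"
    and weyl: "\<And>x. E 1 \<otimes> F (- 1) \<otimes> E 1 \<otimes> E x = F (- x) \<otimes> (E 1 \<otimes> F (- 1) \<otimes> E 1)"
  shows "F (z + 1) = \<one>"
proof -
  have F0: "F 0 = \<one>" and E0: "E 0 = \<one>"
    using E F additive_zero by blast+
  \<comment> \<open>Since \<open>E z' = F 1\<close>, the Weyl element becomes
    \<open>E (2 - z')\<close>. It commutes with \<open>E 1\<close>, so \<open>weyl\<close> at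
    \<open>x = 1\<close> collapses to \<open>E 1 = F (- 1)\<close>, while \<open>EF\<close> gives
    \<open>E 1 = F z\<close>.\<close>
  have "E z' \<otimes> F (- 1) = \<one>"
    using EF [of z'] z' F(2) [of 1 "- 1"] F0 by simp
  moreover have "E z' \<otimes> E (- z') = \<one>"
    using E(2) [of z' "- z'"] E0 by simp
  ultimately have "F (- 1) = E (- z')"
    using E F by (metis Units_eq Units_l_cancel)
  then have "E 1 \<otimes> F (- 1) \<otimes> E 1 = E (2 - z')"
    using E(2) [of "1 + - z'" 1] E(2) [of 1 "- z'"] by (simp add: algebra_simps)
  with weyl [of 1] have "E 1 \<otimes> E (2 - z') = F (- 1) \<otimes> E (2 - z')"
    using E(2) by (metis add.commute)
  then have "E 1 = F (- 1)"
    using E F by (metis right_cancel)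
  with EF [of 1] have "F z = F (- 1)" by simp
  then show ?thesis
    using F(2) [of z 1] F(2) [of "- 1" 1] F0 by simp
qed

text \<open>Conjugation without inverses: for concrete matrices, the hypothesis only compares two
  products of integer representatives.\<close>

lemma (in normal) mem_if_conj:
  assumes "g \<in> carrier G" "x \<in> H" "y \<in> carrier G" "g \<otimes> x = y \<otimes> g"
  shows "y \<in> H"
proof -
  have "y = g \<otimes> x \<otimes> inv g"
    using assms by (metis inv_solve_right m_closed)
  then show ?thesis
    using assms inv_op_closed2 by metis
qed

text \<open>Turns relations modulo \<open>H\<close> into equations in a group. Only the kernel of
  the quotient map is remembered, which avoids computing with cosets.\<close>

lemma (in normal) quotient_hom:
  obtains Q :: "'a set monoid" and \<pi> where "group_hom G Q \<pi>"
    "\<And>a. a \<in> carrier G \<Longrightarrow> \<pi> a = \<one>\<^bsub>Q\<^esub> \<longleftrightarrow> a \<in> H"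
proof
  show "group_hom G (G Mod H) (\<lambda>a. H #> a)"
    by (simp add: group_hom_def group_hom_axioms_def factorgroup_is_group r_coset_hom_Mod)
  have "\<one>\<^bsub>G Mod H\<^esub> = H" by (simp add: FactGroup_def)
  then show "H #> a = \<one>\<^bsub>G Mod H\<^esub> \<longleftrightarrow> a \<in> H" if "a \<in> carrier G" for a
    using that subgroup_axioms coset_join1 coset_join2 by metis
qed

text \<open>As \<open>u\<close> is a unit, the powers of \<open>elem_lo m u\<close> exhaust the
  lower unipotent matrices, and a Weyl matrix conjugates these to the upper ones.\<close>

lemma normal_elementary_imp_SL2:
  assumes "m > 1" and N: "N \<lhd> GL2 (residue_ring m)"
    and u: "elem_lo m u \<in> N" "coprime u m"
    and g: "g \<in> carrier (GL2 (residue_ring m))" "det2 (residue_ring m) g = 1"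
  shows "g \<in> N"
proof (rule elementary_imp_SL2 [OF \<open>m > 1\<close> _ _ _ g])
  interpret normal N "GL2 (residue_ring m)" by fact
  show "subgroup N (GL2 (residue_ring m))" by (rule subgroup_axioms)
  have j: "elem_lo m (u * int j) \<in> N" for j
  proof (induction j)
    case 0
    have "elem_lo m 0 = \<one>\<^bsub>GL2 (residue_ring m)\<^esub>"
      using \<open>m > 1\<close> by (simp add: elem_lo_def mat_mod_one)
    then show ?case by simp
  next
    case (Suc j)
    then have "elem_lo m u \<otimes>\<^bsub>GL2 (residue_ring m)\<^esub> elem_lo m (u * int j) \<in> N"
      using u by simp
    then show ?case by (simp add: elem_add algebra_simps)
  qed
  obtain u' where u': "[u * u' = 1] (mod m)"
    using cong_inverse_int [OF u(2)] by blast
  show lo: "elem_lo m x \<in> N" for x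
  proof -
    \<comment> \<open>Reducing \<open>u' * x\<close> modulo \<open>m\<close> makes the multiplier
      nonnegative, as \<open>j\<close> requires.\<close>
    have "[u * (u' * x mod m) = x] (mod m)"
      using cong_mult [OF u' cong_refl [of x]] by (simp add: cong_def mod_simps mult.assoc)
    moreover have "u' * x mod m = int (nat (u' * x mod m))"
      using \<open>m > 1\<close> by simp
    ultimately show ?thesis
      using j [of "nat (u' * x mod m)"] elem_cong by metis
  qed
  show "elem_up m x \<in> N" for x
  proof (rule mem_if_conj)
    show "mat_mod m (0, - 1, 1, 0) \<in> carrier (GL2 (residue_ring m))"
      using \<open>m > 1\<close> by (simp add: mat_mod_in_carrier_iff)
    show "mat_mod m (0, - 1, 1, 0) \<otimes>\<^bsub>GL2 (residue_ring m)\<^esub> elem_lo m (- x) =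
        elem_up m x \<otimes>\<^bsub>GL2 (residue_ring m)\<^esub> mat_mod m (0, - 1, 1, 0)"
      by (simp add: elem_lo_def elem_up_def mat_mod_mult)
  qed (use lo \<open>m > 1\<close> elem_closed in auto)
qed

text \<open>For \<open>m\<close> a power of a prime \<open>l\<close>, the hypothesis
  \<open>unit\<close> says that the matrix is not scalar modulo \<open>l\<close>. A conjugation, if
  necessary, makes the lower left entry a unit; another one, by an upper unipotent matrix, clears
  the top left entry. Determinant and trace survive modulo \<open>m\<close>.\<close>

lemma normal_companion:
  assumes "m > 1" and N: "N \<lhd> GL2 (residue_ring m)"
    and n: "mat_mod m (p, b, r, s) \<in> N"
    and unit: "coprime r m \<or> coprime b m \<or> coprime (p + r - b - s) m"
  obtains b' c' t' where "mat_mod m (0, b', c', t') \<in> N" "coprime c' m"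
    "m dvd - (b' * c') - (p * s - b * r)" "m dvd t' - (p + s)"
proof -
  let ?G = "GL2 (residue_ring m)"
  interpret normal N ?G by fact
  have conj: "mat_mod m y \<in> N"
    if "mat_mod m g \<in> carrier ?G" "mat_mod m x \<in> N" "mat_mod m y \<in> carrier ?G"
      "mat_mod m g \<otimes>\<^bsub>?G\<^esub> mat_mod m x = mat_mod m y \<otimes>\<^bsub>?G\<^esub> mat_mod m g" for g x y
    using mem_if_conj that by blast
  have det: "coprime (p * s - b * r) m"
    using n mem_carrier mat_mod_in_carrier_iff [OF \<open>m > 1\<close>] by blast
  \<comment> \<open>The Weyl matrix swaps the off-diagonal entries up to sign; conjugation by
    \<open>elem_lo m 1\<close> creates the lower left entry \<open>p + r - b - s\<close>.\<close>
  have "\<exists>p' b' r' s'. mat_mod m (p', b', r', s') \<in> N \<and> coprime r' m \<and>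
      p' * s' - b' * r' = p * s - b * r \<and> p' + s' = p + s"
    using unit
  proof (elim disjE)
    assume "coprime r m"
    with n show ?thesis by blast
  next
    assume "coprime b m"
    have "mat_mod m (s, - r, - b, p) \<in> N"
      by (rule conj [of "(0, 1, - 1, 0)" "(p, b, r, s)"])
        (use n det \<open>m > 1\<close> in \<open>simp_all add: mat_mod_in_carrier_iff mat_mod_mult mult.commute\<close>)
    with \<open>coprime b m\<close> show ?thesis
      by (intro exI [of _ s] exI [of _ "- r"] exI [of _ "- b"] exI [of _ p]) (simp add: mult.commute)
  next
    assume c: "coprime (p + r - b - s) m"
    have eq: "(p - b) * (b + s) - b * (p + r - b - s) = p * s - b * r"
      by (simp add: algebra_simps)
    have "mat_mod m (p - b, b, p + r - b - s, b + s) \<in> N"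
      by (rule conj [of "(1, 0, 1, 1)" "(p, b, r, s)"])
        (use n det \<open>m > 1\<close> eq in \<open>simp_all add: mat_mod_in_carrier_iff mat_mod_mult\<close>)
    with c eq show ?thesis by fastforce
  qed
  then obtain p' b' r' s' where n': "mat_mod m (p', b', r', s') \<in> N" "coprime r' m"
    and eqs: "p' * s' - b' * r' = p * s - b * r" "p' + s' = p + s"
    by blast
  obtain r'' where r'': "[r' * r'' = 1] (mod m)"
    using cong_inverse_int [OF n'(2)] by blast
  \<comment> \<open>\<open>y\<close> solves \<open>p' + y * r' = 0\<close> modulo \<open>m\<close>,
    and \<open>b''\<close> below is the exact upper right entry after conjugation by
    \<open>elem_up m y\<close>. Only the top left entry gets replaced, by 0.\<close>
  define y where "y = - p' * r''"
  have y: "m dvd p' + y * r'"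
  proof -
    have "p' + y * r' = - p' * (r' * r'' - 1)"
      by (simp add: y_def algebra_simps)
    then show ?thesis
      using r'' by (simp add: cong_iff_dvd_diff)
  qed
  define b'' where "b'' = b' + y * s' - y * (p' + y * r')"
  have det': "m dvd - (b'' * r') - (p * s - b * r)"
  proof -
    have "- (b'' * r') - (p' * s' - b' * r') = (p' + y * r') * (y * r' - s')"
      by (simp add: b''_def algebra_simps)
    then show ?thesis using y eqs by simp
  qed
  have "coprime (b'' * r') m"
    using det det' cong_imp_coprime cong_iff_dvd_diff coprime_minus_left_iff cong_sym by metis
  have "mat_mod m (0, b'', r', s' - y * r') \<in> N"
  proof (rule conj [of "(1, y, 0, 1)" "(p', b', r', s')"])
    show "mat_mod m (0, b'', r', s' - y * r') \<in> carrier ?G"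
      using \<open>coprime (b'' * r') m\<close> \<open>m > 1\<close> by (simp add: mat_mod_in_carrier_iff)
    show "mat_mod m (1, y, 0, 1) \<otimes>\<^bsub>?G\<^esub> mat_mod m (p', b', r', s') =
        mat_mod m (0, b'', r', s' - y * r') \<otimes>\<^bsub>?G\<^esub> mat_mod m (1, y, 0, 1)"
      unfolding mat_mod_mult using y dvd_mult2 [OF y, of y]
      by (intro mat_mod_eqI) (simp_all add: b''_def algebra_simps)
  qed (use \<open>m > 1\<close> n' in \<open>simp_all add: mat_mod_in_carrier_iff\<close>)
  moreover have "m dvd s' - y * r' - (p + s)"
    using y by (simp flip: eqs(2) add: dvd_diff_commute)
  ultimately show thesis
    using that n'(2) det' by blast
qed

text \<open>A matrix with zero top left entry maps the first basis vector to a multiple of the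
  second, so it conjugates upper unipotent matrices, which fix the first, to lower ones, which fix
  the second. As its image under \<open>\<pi>\<close> is trivial, the images of both agree. The
  factor \<open>z\<close> is \<open>c / b\<close>.\<close>

lemma elem_quotient_relation:
  assumes "m > 1" and "group_hom (GL2 (residue_ring m)) Q \<pi>"
    and n: "mat_mod m (0, b, c, t) \<in> carrier (GL2 (residue_ring m))"
      "\<pi> (mat_mod m (0, b, c, t)) = \<one>\<^bsub>Q\<^esub>"
    and z: "[z * b = c] (mod m)"
  shows "\<pi> (elem_up m x) = \<pi> (elem_lo m (z * x))"
proof -
  let ?G = "GL2 (residue_ring m)" and ?n = "mat_mod m (0, b, c, t)"
  interpret group_hom ?G Q \<pi> by fact
  have z': "m dvd z * b - c" using z by (simp add: cong_iff_dvd_diff)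
  have "z * x * b - c * x = (z * b - c) * x" by (simp add: algebra_simps)
  then have "m dvd c * x - z * x * b"
    using z' by (metis dvd_diff_commute dvd_mult2)
  then have "?n \<otimes>\<^bsub>?G\<^esub> elem_up m x = elem_lo m (z * x) \<otimes>\<^bsub>?G\<^esub> ?n"
    unfolding elem_up_def elem_lo_def mat_mod_mult
    by (intro mat_mod_eqI) simp_all
  moreover have "elem_up m x \<in> carrier ?G" "elem_lo m (z * x) \<in> carrier ?G"
    using elem_closed [OF \<open>m > 1\<close>] by blast+
  ultimately show ?thesis
    using n by (metis H.l_one H.r_one hom_closed hom_mult)
qed

text \<open>Modulo \<open>N\<close>, the given matrix identifies the upper with the lower unipotent
  matrices through the factor \<open>z\<close>, and the Weyl element through the factor -1. The
  comparison is of use when \<open>z + 1\<close> is a unit.\<close>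

lemma normal_elem_lo_if_braid:
  assumes "m > 1" and N: "N \<lhd> GL2 (residue_ring m)"
    and n: "mat_mod m (0, b, c, t) \<in> N"
    and z: "[z * b = c] (mod m)" "[z * z' = 1] (mod m)"
  shows "elem_lo m (z + 1) \<in> N"
proof -
  let ?G = "GL2 (residue_ring m)"
  interpret normal N ?G by fact
  obtain Q :: "int mat2 set monoid" and \<pi> where hom: "group_hom ?G Q \<pi>"
    and ker: "\<And>a. a \<in> carrier ?G \<Longrightarrow> \<pi> a = \<one>\<^bsub>Q\<^esub> \<longleftrightarrow> a \<in> N"
    using quotient_hom by blast
  interpret \<pi>: group_hom ?G Q \<pi> by fact
  note cl [simp] = elem_closed [OF \<open>m > 1\<close>]
  have "\<pi> (elem_lo m (z + 1)) = \<one>\<^bsub>Q\<^esub>"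
  proof (rule \<pi>.H.unipotent_relation [where E = "\<lambda>x. \<pi> (elem_up m x)" and z' = z'])
    show "\<pi> (elem_lo m (z * z')) = \<pi> (elem_lo m 1)"
      using elem_cong z(2) by simp
    show "\<pi> (elem_up m 1) \<otimes>\<^bsub>Q\<^esub> \<pi> (elem_lo m (- 1)) \<otimes>\<^bsub>Q\<^esub> \<pi> (elem_up m 1) \<otimes>\<^bsub>Q\<^esub> \<pi> (elem_up m x) =
        \<pi> (elem_lo m (- x)) \<otimes>\<^bsub>Q\<^esub>
          (\<pi> (elem_up m 1) \<otimes>\<^bsub>Q\<^esub> \<pi> (elem_lo m (- 1)) \<otimes>\<^bsub>Q\<^esub> \<pi> (elem_up m 1))" for x
    proof -
      \<comment> \<open>The triple product is the Weyl matrix \<open>(0, 1, - 1, 0)\<close>.\<close>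
      have "elem_up m 1 \<otimes>\<^bsub>?G\<^esub> elem_lo m (- 1) \<otimes>\<^bsub>?G\<^esub> elem_up m 1 \<otimes>\<^bsub>?G\<^esub> elem_up m x =
          elem_lo m (- x) \<otimes>\<^bsub>?G\<^esub> (elem_up m 1 \<otimes>\<^bsub>?G\<^esub> elem_lo m (- 1) \<otimes>\<^bsub>?G\<^esub> elem_up m 1)"
        by (simp add: elem_up_def elem_lo_def mat_mod_mult)
      then show ?thesis
        by (simp flip: \<pi>.hom_mult)
    qed
    show "\<pi> (elem_up m x) = \<pi> (elem_lo m (z * x))" for x
      using elem_quotient_relation [OF \<open>m > 1\<close> hom _ _ z(1)] n ker mem_carrier by blast
  qed (simp_all flip: elem_add)
  then show ?thesis
    using ker cl by blast
qed

section \<open>From one non-scalar element to all of \<open>SL2\<close>: odd \<open>l\<close>, then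
  \<open>l = 2\<close>\<close>

lemma coprime_prime_power_iff:
  fixes c :: int
  assumes "prime l" "k \<ge> 1"
  shows "coprime c (int l ^ k) \<longleftrightarrow> \<not> int l dvd c"
proof -
  have "coprime c (int l ^ k) \<longleftrightarrow> coprime c (int l)"
    using assms by simp
  also have "\<dots> \<longleftrightarrow> \<not> int l dvd c"
    using assms(1) prime_imp_coprime [of "int l" c] coprime_common_divisor [of c "int l" "int l"]
    by (auto simp: coprime_commute)
  finally show ?thesis .
qed

text \<open>Squaring identifies the residues 1 and \<open>l - 1\<close>, which differ for
  \<open>l > 2\<close>; on a finite set it is then not surjective either.\<close>

lemma exists_nonresidue:
  assumes "prime l" "l \<noteq> 2"
  obtains u :: int where "\<And>x. \<not> int l dvd x * x - u"
proof -
  have l: "int l > 2"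
    using assms prime_ge_2_nat [of l] by linarith
  let ?A = "{0..<int l}" and ?f = "\<lambda>x. x * x mod int l"
  have "\<not> inj_on ?f ?A"
  proof
    have "(int l - 1) * (int l - 1) = 1 + int l * (int l - 2)"
      by (simp add: algebra_simps)
    then have "?f (int l - 1) = ?f 1" by simp
    moreover assume "inj_on ?f ?A"
    ultimately have "int l - 1 = 1"
      using l inj_onD [of ?f ?A "int l - 1" 1] by simp
    with l show False by simp
  qed
  then have "\<not> ?A \<subseteq> ?f ` ?A"
    using finite_surj_inj [of ?A ?f] by auto
  then obtain u where u: "u \<in> ?A" "u \<notin> ?f ` ?A" by blast
  have "\<not> int l dvd x * x - u" for x
  proof
    assume "int l dvd x * x - u"
    then have "u = ?f (x mod int l)"
      using u(1) by (simp add: mod_eq_dvd_iff [symmetric] mod_simps)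
    moreover have "x mod int l \<in> ?A" using l by simp
    ultimately show False using u(2) by blast
  qed
  then show thesis by (rule that)
qed

text \<open>An element of \<open>N\<close> whose determinant \<open>u\<close> is a nonresidue is not
  scalar modulo \<open>l\<close>, since scalar matrices have square determinants. Its companion form
  has \<open>- (b' * c) = u\<close> modulo \<open>l\<close>, so \<open>c = - b'\<close> is excluded
  as well, and \<open>z + 1\<close> is a unit for \<open>z = c / b'\<close>.\<close>

lemma normal_contains_SL2_odd:
  assumes l: "prime l" "l \<noteq> 2" and k: "k \<ge> 1" and m: "m = int l ^ k"
    and N: "N \<lhd> GL2 (residue_ring m)"
    and dets: "\<And>u. coprime u m \<Longrightarrow> \<exists>n\<in>N. det2 (residue_ring m) n = u mod m"
    and g: "g \<in> carrier (GL2 (residue_ring m))" "det2 (residue_ring m) g = 1"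
  shows "g \<in> N"
proof -
  let ?G = "GL2 (residue_ring m)"
  interpret normal N ?G by fact
  have "int l > 1" using l prime_gt_1_nat by fastforce
  then have m1: "m > 1" using k by (simp add: m)
  have l_dvd_m: "int l dvd m" using k by (simp add: m)
  note cop = coprime_prime_power_iff [OF l(1) k, folded m]
  obtain u where u: "\<And>x. \<not> int l dvd x * x - u"
    using exists_nonresidue [OF l] by blast
  have "\<not> int l dvd u" using u [of 0] by simp
  then obtain n where n: "n \<in> N" "det2 (residue_ring m) n = u mod m"
    using dets cop by blast
  obtain p b r s where n_eq: "n = mat_mod m (p, b, r, s)"
    using GL2_residue_cases [OF m1 mem_carrier [OF n(1)]] by metis
  have "m dvd p * s - b * r - u"
    using n(2) m1 by (simp add: n_eq det2_mat_mod mod_eq_dvd_iff)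
  then have det: "int l dvd p * s - b * r - u"
    using l_dvd_m dvd_trans by blast
  have "coprime r m \<or> coprime b m \<or> coprime (p + r - b - s) m"
  proof (rule ccontr)
    assume "\<not> ?thesis"
    then have *: "int l dvd r" "int l dvd b" "int l dvd p + r - b - s"
      by (simp_all add: cop)
    have "p * p - u = (p * s - b * r - u) + p * (p + r - b - s) + (b - p) * r + p * b"
      by (simp add: algebra_simps)
    also have "int l dvd \<dots>"
      using * det by (intro dvd_add) simp_all
    finally show False using u by blast
  qed
  then obtain b' c t where n': "mat_mod m (0, b', c, t) \<in> N" "coprime c m"
    "m dvd - (b' * c) - (p * s - b * r)"
    using normal_companion [OF m1 N n(1) [unfolded n_eq]] by metis
  have "int l dvd - (b' * c) - (p * s - b * r) + (p * s - b * r - u)"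
    by (rule dvd_add [OF dvd_trans [OF l_dvd_m n'(3)] det])
  then have bc: "int l dvd - (b' * c) - u" by simp
  have "\<not> int l dvd b'"
  proof
    assume "int l dvd b'"
    then have "int l dvd b' * c" by simp
    with bc have "int l dvd - (- (b' * c) - u) - b' * c"
      by (metis dvd_diff dvd_minus_iff)
    then have "int l dvd u" by simp
    with \<open>\<not> int l dvd u\<close> show False ..
  qed
  have "\<not> int l dvd b' + c"
  proof
    assume *: "int l dvd b' + c"
    have "c * c - u = (- (b' * c) - u) + c * (b' + c)"
      by (simp add: algebra_simps)
    also have "int l dvd \<dots>" using bc * by (intro dvd_add) simp_all
    finally show False using u by blast
  qed
  \<comment> \<open>\<open>c * b''\<close> is the factor \<open>z = c / b'\<close>, and
    \<open>b' * c'\<close> is its inverse.\<close>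
  obtain b'' where b'': "[b' * b'' = 1] (mod m)"
    using cong_inverse_int \<open>\<not> int l dvd b'\<close> cop by blast
  obtain c' where c': "[c * c' = 1] (mod m)"
    using cong_inverse_int n'(2) by blast
  have z: "[c * b'' * b' = c] (mod m)"
    using cong_scalar_left [OF b'', of c] by (simp add: ac_simps)
  have z': "[(c * b'') * (b' * c') = 1] (mod m)"
    using cong_mult [OF b'' c'] by (simp add: ac_simps)
  have "\<not> int l dvd c * b'' + 1"
  proof
    assume *: "int l dvd c * b'' + 1"
    have **: "int l dvd c * b'' * b' - c"
      using z l_dvd_m dvd_trans by (auto simp: cong_iff_dvd_diff)
    have "int l dvd b' * (c * b'' + 1) - (c * b'' * b' - c)"
      by (rule dvd_diff [OF dvd_mult [OF *] **])
    also have "b' * (c * b'' + 1) - (c * b'' * b' - c) = b' + c"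
      by (simp add: algebra_simps)
    finally show False using \<open>\<not> int l dvd b' + c\<close> by blast
  qed
  then show ?thesis
    using normal_elementary_imp_SL2 [OF m1 N normal_elem_lo_if_braid [OF m1 N n'(1) z z'] _ g] cop
    by blast
qed

text \<open>Here \<open>b'\<close> and \<open>c\<close> are odd, so \<open>z + 1\<close> is even and
  the argument for odd \<open>l\<close> breaks down. Instead, the companion form is conjugate to
  \<open>elem_lo m c\<close> times \<open>elem_up m (y * (t - 2))\<close>, and modulo
  \<open>N\<close> the first factor equals \<open>elem_up m b'\<close>. Hence
  \<open>elem_up m (b' + y * (t - 2))\<close> lies in \<open>N\<close>, and its parameter is odd
  because \<open>t\<close> is even.\<close>

lemma normal_contains_SL2_two:
  assumes k: "k \<ge> 1" and m: "m = 2 ^ k"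
    and N: "N \<lhd> GL2 (residue_ring m)"
    and n: "mat_mod m (p, b, r, s) \<in> N" "m dvd p * s - b * r - 1" "even (p + s)" "odd b \<or> odd r"
    and g: "g \<in> carrier (GL2 (residue_ring m))" "det2 (residue_ring m) g = 1"
  shows "g \<in> N"
proof -
  let ?G = "GL2 (residue_ring m)"
  interpret normal N ?G by fact
  obtain Q :: "int mat2 set monoid" and \<pi> where hom: "group_hom ?G Q \<pi>"
    and ker: "\<And>a. a \<in> carrier ?G \<Longrightarrow> \<pi> a = \<one>\<^bsub>Q\<^esub> \<longleftrightarrow> a \<in> N"
    using quotient_hom by blast
  interpret \<pi>: group_hom ?G Q \<pi> by fact
  have m1: "m > 1" using k by (simp add: m)
  have even_m: "2 dvd m" using k by (simp add: m)
  have cop: "coprime x m \<longleftrightarrow> odd x" for x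
    using k by (simp add: m)
  have "coprime r m \<or> coprime b m \<or> coprime (p + r - b - s) m"
    using n(4) cop by blast
  then obtain b' c t where n': "mat_mod m (0, b', c, t) \<in> N" "coprime c m"
    "m dvd - (b' * c) - (p * s - b * r)" "m dvd t - (p + s)"
    using normal_companion [OF m1 N n(1)] by metis
  have bc: "m dvd - (b' * c) - 1"
    using dvd_add [OF n'(3) n(2)] by simp
  have "2 dvd t - (p + s)"
    using n'(4) even_m dvd_trans by blast
  then have "even t" using n(3) by simp
  \<comment> \<open>\<open>y\<close> is the inverse of \<open>c\<close>; determinant 1 makes it
    \<open>- b'\<close> modulo \<open>m\<close>.\<close>
  obtain y where y: "m dvd c * y - 1"
    using cong_inverse_int [OF n'(2)] by (auto simp: cong_iff_dvd_diff)
  have "b' + y = (c * y - 1) * (- b') - y * (- (b' * c) - 1)"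
    by (simp add: algebra_simps)
  then have b'y: "m dvd b' + y" using y bc by (metis dvd_diff dvd_mult dvd_mult2)
  have "2 dvd c * y - 1" using y even_m dvd_trans by blast
  then have "odd y" "odd c" by auto
  moreover have "2 dvd b' + y" using b'y even_m dvd_trans by blast
  ultimately have "odd b'" by auto
  have cl [simp]: "elem_up m x \<in> carrier ?G" "elem_lo m x \<in> carrier ?G" for x
    using elem_closed [OF m1] by auto
  \<comment> \<open>The trace of \<open>elem_lo m c\<close> times \<open>elem_up m x\<close> is
    \<open>2 + c * x\<close>; equating it with the trace \<open>t\<close> gives
    \<open>x = y * (t - 2)\<close>.\<close>
  have "elem_lo m c \<otimes>\<^bsub>?G\<^esub> elem_up m (y * (t - 2)) \<in> N"
  proof (rule mem_if_conj)
    show "elem_up m y \<otimes>\<^bsub>?G\<^esub> mat_mod m (0, b', c, t) =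
        elem_lo m c \<otimes>\<^bsub>?G\<^esub> elem_up m (y * (t - 2)) \<otimes>\<^bsub>?G\<^esub> elem_up m y"
      unfolding elem_up_def elem_lo_def mat_mod_mult
    proof (rule mat_mod_eqI)
      have "t - 1 - c * y * (t - 1) = - (c * y - 1) * (t - 1)"
        by (simp add: algebra_simps)
      then have "m dvd t - 1 - c * y * (t - 1)"
        using y by (metis dvd_minus_iff dvd_mult2)
      then show "m dvd 0 * b' + 1 * t - ((c * 1 + 1 * 0) * y + (c * (y * (t - 2)) + 1 * 1) * 1)"
        by (simp add: algebra_simps)
      show "m dvd 1 * 0 + y * c - ((1 * 1 + 0 * 0) * 1 + (1 * (y * (t - 2)) + 0 * 1) * 0)"
        using y by (simp add: mult.commute)
      show "m dvd 1 * b' + y * t - ((1 * 1 + 0 * 0) * y + (1 * (y * (t - 2)) + 0 * 1) * 1)"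
        using b'y by (simp add: algebra_simps)
    qed simp
  qed (use n' in simp_all)
  then have "\<pi> (elem_lo m c) \<otimes>\<^bsub>Q\<^esub> \<pi> (elem_up m (y * (t - 2))) = \<one>\<^bsub>Q\<^esub>"
    using ker by (simp flip: \<pi>.hom_mult)
  moreover have "\<pi> (elem_up m b') = \<pi> (elem_lo m c)"
  proof -
    \<comment> \<open>The relation with \<open>z = c * b''\<close> is used at \<open>x = b'\<close>,
      where \<open>z * x\<close> is \<open>c\<close> modulo \<open>m\<close>.\<close>
    obtain b'' where b'': "[b' * b'' = 1] (mod m)"
      using cong_inverse_int \<open>odd b'\<close> cop by blast
    have z: "[c * b'' * b' = c] (mod m)"
      using cong_scalar_left [OF b'', of c] by (simp add: ac_simps)
    show ?thesis
      using elem_quotient_relation [OF m1 hom mem_carrier [OF n'(1)] _ z, of b'] elem_cong(2) [OF z]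
        n'(1) ker mem_carrier by simp
  qed
  ultimately have "\<pi> (elem_up m (b' + y * (t - 2))) = \<one>\<^bsub>Q\<^esub>"
    by (simp flip: elem_add)
  then have "elem_up m (b' + y * (t - 2)) \<in> N"
    using ker by simp
  then have "elem_lo m (- (b' + y * (t - 2))) \<in> N"
  proof (rule mem_if_conj [rotated])
    show "mat_mod m (0, 1, - 1, 0) \<in> carrier ?G"
      using m1 by (simp add: mat_mod_in_carrier_iff)
    show "mat_mod m (0, 1, - 1, 0) \<otimes>\<^bsub>?G\<^esub> elem_up m (b' + y * (t - 2)) =
        elem_lo m (- (b' + y * (t - 2))) \<otimes>\<^bsub>?G\<^esub> mat_mod m (0, 1, - 1, 0)"
      by (simp add: elem_lo_def elem_up_def mat_mod_mult)
  qed simp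
  moreover have "coprime (- (b' + y * (t - 2))) m"
    using \<open>odd b'\<close> \<open>even t\<close> by (simp add: cop)
  ultimately show ?thesis
    by (rule normal_elementary_imp_SL2 [OF m1 N _ _ g])
qed

text \<open>Once \<open>N\<close> contains \<open>SL2\<close>, dividing \<open>g\<close> by an
  element of \<open>N\<close> of the same determinant leaves an element of \<open>N\<close>. For
  \<open>l = 2\<close> determinants alone are not enough, as the kernel of the sign attains them
  all; \<open>two\<close> asks for determinant 1 together with sign -1, expressed by
  parities.\<close>

lemma normal_eq_GL2:
  assumes l: "prime l" and k: "k \<ge> 1" and m: "m = int l ^ k"
    and N: "N \<lhd> GL2 (residue_ring m)"
    and dets: "\<And>u. coprime u m \<Longrightarrow> \<exists>n\<in>N. det2 (residue_ring m) n = u mod m"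
    and two: "l = 2 \<Longrightarrow> \<exists>p b r s. mat_mod m (p, b, r, s) \<in> N \<and> m dvd p * s - b * r - 1 \<and>
      even (p + s) \<and> (odd b \<or> odd r)"
  shows "N = carrier (GL2 (residue_ring m))"
proof
  let ?G = "GL2 (residue_ring m)" and ?R = "residue_ring m"
  interpret normal N ?G by fact
  have "int l > 1" using l prime_gt_1_nat by fastforce
  then have m1: "m > 1" using k by (simp add: m)
  interpret R: residues m ?R by unfold_locales (use m1 in simp_all)
  show "N \<subseteq> carrier ?G" by (rule subset)
  show "carrier ?G \<subseteq> N"
  proof
    fix g assume g: "g \<in> carrier ?G"
    then obtain a b c d where abcd: "g = mat_mod m (a, b, c, d)" "coprime (a * d - b * c) m"
      using GL2_residue_cases [OF m1] by metis
    then obtain n where n: "n \<in> N" "det2 ?R n = det2 ?R g"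
      using dets det2_mat_mod [OF m1] by metis
    define h where "h = g \<otimes>\<^bsub>?G\<^esub> inv\<^bsub>?G\<^esub> n"
    have h: "h \<in> carrier ?G" "g = h \<otimes>\<^bsub>?G\<^esub> n"
      using g n mem_carrier by (simp_all add: h_def m_assoc)
    have "det2 ?R g = det2 ?R h \<otimes>\<^bsub>?R\<^esub> det2 ?R n"
      using h n mem_carrier R.det2_mult by (simp add: R.carrier_GL2_iff mult_GL2)
    moreover have "det2 ?R n \<in> Units ?R" "det2 ?R h \<in> Units ?R"
      using h n mem_carrier R.carrier_GL2_iff by blast+
    ultimately have "det2 ?R h = \<one>\<^bsub>?R\<^esub>"
      using n(2) R.Units_closed R.Units_l_cancel R.m_comm R.r_one R.one_closed by metis
    then have "det2 ?R h = 1" by (simp add: R.res_one_eq)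
    have "h \<in> N"
    proof (cases "l = 2")
      case True
      then obtain p b r s where *: "mat_mod m (p, b, r, s) \<in> N" "m dvd p * s - b * r - 1"
        "even (p + s)" "odd b \<or> odd r"
        using two by blast
      have "m = 2 ^ k" using True m by simp
      then show ?thesis
        using normal_contains_SL2_two [OF k _ N *] h(1) \<open>det2 ?R h = 1\<close> by blast
    next
      case False
      then show ?thesis
        using normal_contains_SL2_odd [OF l _ k m N dets] h(1) \<open>det2 ?R h = 1\<close> by blast
    qed
    then show "g \<in> N" using h(2) n(1) by simp
  qed
qed

section \<open>Inverse limits of residue rings\<close>

lemma residue_lim_carrier_iff:
  "x \<in> carrier (residue_lim D) \<longleftrightarrow>
    x \<in> extensional D \<and> (\<forall>m\<in>D. 0 \<le> x m \<and> x m < m) \<and>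
    (\<forall>m\<in>D. \<forall>n\<in>D. m dvd n \<longrightarrow> x n mod m = x m)"
  by (fastforce simp: residue_lim_def residue_ring_ops PiE_iff)

lemma residue_lim_ops:
  "x \<otimes>\<^bsub>residue_lim D\<^esub> y = (\<lambda>m\<in>D. (x m * y m) mod m)"
  "x \<oplus>\<^bsub>residue_lim D\<^esub> y = (\<lambda>m\<in>D. (x m + y m) mod m)"
  "\<one>\<^bsub>residue_lim D\<^esub> = (\<lambda>m\<in>D. 1)" "\<zero>\<^bsub>residue_lim D\<^esub> = (\<lambda>m\<in>D. 0)"
  by (simp_all add: residue_lim_def residue_ring_ops)

text \<open>Produces elements of the limit from integers that are compatible only up to congruence:
  reduction picks the canonical representatives, restriction gives extensionality.\<close>

definition residue_family :: "int set \<Rightarrow> (int \<Rightarrow> int) \<Rightarrow> int \<Rightarrow> int" where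
  "residue_family D f = (\<lambda>m\<in>D. f m mod m)"

lemma residue_family_closed:
  assumes "D \<subseteq> {1<..}" "\<And>m n. m \<in> D \<Longrightarrow> n \<in> D \<Longrightarrow> m dvd n \<Longrightarrow> [f n = f m] (mod m)"
  shows "residue_family D f \<in> carrier (residue_lim D)"
proof -
  have "f n mod n mod m = f m mod m" if "m \<in> D" "n \<in> D" "m dvd n" for m n
    using assms(2) [OF that] that by (simp add: mod_mod_cancel cong_def)
  then show ?thesis
    using assms(1) by (force simp: residue_lim_carrier_iff residue_family_def)
qed

lemma residue_lim_op_closed:
  assumes "D \<subseteq> {1<..}" "x \<in> carrier (residue_lim D)" "y \<in> carrier (residue_lim D)"
  shows "(\<lambda>m\<in>D. (x m * y m) mod m) \<in> carrier (residue_lim D)"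
    "(\<lambda>m\<in>D. (x m + y m) mod m) \<in> carrier (residue_lim D)"
    "(\<lambda>m\<in>D. (- x m) mod m) \<in> carrier (residue_lim D)"
proof -
  have "[x n = x m] (mod m)" "[y n = y m] (mod m)" if "m \<in> D" "n \<in> D" "m dvd n" for m n
    using assms that by (auto simp: residue_lim_carrier_iff cong_def)
  then show "(\<lambda>m\<in>D. (x m * y m) mod m) \<in> carrier (residue_lim D)"
    "(\<lambda>m\<in>D. (x m + y m) mod m) \<in> carrier (residue_lim D)"
    "(\<lambda>m\<in>D. (- x m) mod m) \<in> carrier (residue_lim D)"
    using residue_family_closed [OF assms(1), of "\<lambda>m. x m * y m"]
      residue_family_closed [OF assms(1), of "\<lambda>m. x m + y m"]
      residue_family_closed [OF assms(1), of "\<lambda>m. - x m"]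
    by (simp_all add: residue_family_def cong_mult cong_add cong_minus_minus_iff)
qed

lemma residue_lim_ext:
  assumes "x \<in> carrier (residue_lim D)" "y \<in> carrier (residue_lim D)" "\<And>m. m \<in> D \<Longrightarrow> x m = y m"
  shows "x = y"
  using assms by (intro extensionalityI) (auto simp: residue_lim_carrier_iff)

lemma cring_residue_lim:
  assumes D: "D \<subseteq> {1<..}"
  shows "cring (residue_lim D)"
proof (rule cringI)
  note cl = residue_lim_op_closed [OF D]
  have one: "(\<lambda>m\<in>D. 1) \<in> carrier (residue_lim D)" and zero: "(\<lambda>m\<in>D. 0) \<in> carrier (residue_lim D)"
    using D by (auto simp: residue_lim_carrier_iff)
  have red: "x m mod m = x m" if "x \<in> carrier (residue_lim D)" "m \<in> D" for x m
    using that by (auto simp: residue_lim_carrier_iff)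
  show "abelian_group (residue_lim D)"
  proof (rule abelian_groupI)
    fix x assume x: "x \<in> carrier (residue_lim D)"
    show "\<exists>y\<in>carrier (residue_lim D). y \<oplus>\<^bsub>residue_lim D\<^esub> x = \<zero>\<^bsub>residue_lim D\<^esub>"
      by (rule bexI [OF _ cl(3) [OF x x]])
        (auto simp: residue_lim_ops mod_simps intro!: restrict_ext)
    show "\<zero>\<^bsub>residue_lim D\<^esub> \<oplus>\<^bsub>residue_lim D\<^esub> x = x"
      by (rule residue_lim_ext [of _ D]) (use x zero cl(2) [OF zero x] in \<open>auto simp: residue_lim_ops red\<close>)
  qed (use cl zero in \<open>auto simp: residue_lim_ops mod_simps algebra_simps intro!: restrict_ext\<close>)
  show "Group.comm_monoid (residue_lim D)"
  proof (rule comm_monoidI)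
    fix x assume x: "x \<in> carrier (residue_lim D)"
    show "\<one>\<^bsub>residue_lim D\<^esub> \<otimes>\<^bsub>residue_lim D\<^esub> x = x"
      by (rule residue_lim_ext [of _ D]) (use x one cl(1) [OF one x] in \<open>auto simp: residue_lim_ops red\<close>)
  qed (use cl one in \<open>auto simp: residue_lim_ops mod_simps algebra_simps intro!: restrict_ext\<close>)
qed (auto simp: residue_lim_ops mod_simps algebra_simps intro!: restrict_ext)

lemma residue_lim_eval_hom:
  assumes "D \<subseteq> {1<..}" "m \<in> D"
  shows "ring_hom_cring (residue_lim D) (residue_ring m) (\<lambda>x. x m)"
proof (rule ring_hom_cringI)
  show "cring (residue_lim D)" by (rule cring_residue_lim) fact
  show "cring (residue_ring m)"
    using assms residues.cring [of m] by (auto simp: residues_def)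
  show "(\<lambda>x. x m) \<in> ring_hom (residue_lim D) (residue_ring m)"
    using assms
    by (auto simp: ring_hom_def residue_lim_ops residue_ring_ops residue_lim_carrier_iff)
qed

lemma residue_lim_restrict_hom:
  assumes "D \<subseteq> {1<..}" "D' \<subseteq> D"
  shows "ring_hom_cring (residue_lim D) (residue_lim D') (\<lambda>x. restrict x D')"
proof (rule ring_hom_cringI)
  show "cring (residue_lim D)" "cring (residue_lim D')"
    using assms by (auto intro: cring_residue_lim)
  have "restrict x D' \<in> carrier (residue_lim D')" if "x \<in> carrier (residue_lim D)" for x
    using that assms(2) by (auto simp: residue_lim_carrier_iff subset_iff)
  then show "(\<lambda>x. restrict x D') \<in> ring_hom (residue_lim D) (residue_lim D')"
    using assms(2) by (auto simp: ring_hom_def residue_lim_ops subset_iff intro!: restrict_ext)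
qed

lemma Units_residue_lim_iff:
  assumes D: "D \<subseteq> {1<..}"
  shows "x \<in> Units (residue_lim D) \<longleftrightarrow>
    x \<in> carrier (residue_lim D) \<and> (\<forall>m\<in>D. coprime (x m) m)"
proof
  interpret cring "residue_lim D" by (rule cring_residue_lim) fact
  assume x: "x \<in> Units (residue_lim D)"
  have "coprime (x m) m" if m: "m \<in> D" for m
  proof -
    have "x m \<in> Units (residue_ring m)"
      using ring_hom_cring.Units_hom [OF residue_lim_eval_hom [OF D m]] x by blast
    moreover have "x m = x m mod m"
      using Units_closed [OF x] m by (auto simp: residue_lim_carrier_iff)
    ultimately show ?thesis
      using mod_in_Units_residue_ring [of m "x m"] D m by auto
  qed
  then show "x \<in> carrier (residue_lim D) \<and> (\<forall>m\<in>D. coprime (x m) m)"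
    using x by blast
next
  interpret cring "residue_lim D" by (rule cring_residue_lim) fact
  assume x: "x \<in> carrier (residue_lim D) \<and> (\<forall>m\<in>D. coprime (x m) m)"
  then have "\<forall>m\<in>D. \<exists>y. [x m * y = 1] (mod m)"
    using cong_solve_coprime_int by blast
  then obtain y where y: "\<And>m. m \<in> D \<Longrightarrow> [x m * y m = 1] (mod m)"
    by metis
  have "residue_family D y \<in> carrier (residue_lim D)"
  proof (rule residue_family_closed [OF D])
    fix m n assume mn: "m \<in> D" "n \<in> D" "m dvd n"
    then have "x n mod m = x m"
      using x by (simp add: residue_lim_carrier_iff)
    then have "m dvd x m - x n"
      by (metis dvd_diff_commute dvd_minus_mod)
    moreover have "m dvd x m * y m - 1" "n dvd x n * y n - 1"
      using y mn by (simp_all add: cong_iff_dvd_diff)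
    ultimately have *: "m dvd x n * y n - 1" "m dvd x m * y m - 1" "m dvd x m - x n"
      using mn(3) dvd_trans by blast+
    \<comment> \<open>Inverses modulo \<open>m\<close> are unique, so those chosen separately at
      each modulus are compatible.\<close>
    have "y n - y m = y m * (x n * y n - 1) - y n * (x m * y m - 1) + y n * y m * (x m - x n)"
      by (simp add: algebra_simps)
    also have "m dvd \<dots>"
      by (rule dvd_add [OF dvd_diff [OF dvd_mult [OF *(1)] dvd_mult [OF *(2)]] dvd_mult [OF *(3)]])
    finally show "[y n = y m] (mod m)" by (simp add: cong_iff_dvd_diff)
  qed
  moreover have "x \<otimes>\<^bsub>residue_lim D\<^esub> residue_family D y = \<one>\<^bsub>residue_lim D\<^esub>"
    using y D
    by (auto simp: residue_lim_ops residue_family_def mod_simps cong_def intro!: restrict_ext)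
  ultimately show "x \<in> Units (residue_lim D)"
    using x Units_if_r_inv by blast
qed

lemma carrier_GL2_residue_lim_iff:
  assumes D: "D \<subseteq> {1<..}"
  shows "g \<in> carrier (GL2 (residue_lim D)) \<longleftrightarrow> g \<in> carrier (M2 (residue_lim D)) \<and>
    (\<forall>m\<in>D. coprime (det2 (residue_lim D) g m) m)"
  using cring.carrier_GL2_iff [OF cring_residue_lim [OF D]] Units_residue_lim_iff [OF D]
    cring.det2_closed [OF cring_residue_lim [OF D]] by blast

section \<open>Reductions of \<open>GL2 Zhat\<close> and gluing of local components\<close>

definition red :: "int \<Rightarrow> (int \<Rightarrow> int) mat2 \<Rightarrow> int mat2" where
  "red m = map_mat2 (\<lambda>x. x m)"

lemma prime_powers_subset: "prime l \<Longrightarrow> prime_powers l \<subseteq> {1<..}"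
  using prime_gt_1_nat [of l] by (auto simp: prime_powers_def intro!: one_less_power)

lemma Zhat_carrier_iff:
  "x \<in> carrier Zhat \<longleftrightarrow> x \<in> extensional {m. m > 1} \<and> (\<forall>m>1. 0 \<le> x m \<and> x m < m) \<and>
    (\<forall>m>1. \<forall>n>1. m dvd n \<longrightarrow> x n mod m = x m)"
  by (auto simp: Zhat_def residue_lim_carrier_iff)

lemma cring_Zhat: "cring Zhat"
  unfolding Zhat_def by (rule cring_residue_lim) auto

lemma Zhat_eval_hom: "m > 1 \<Longrightarrow> ring_hom_cring Zhat (residue_ring m) (\<lambda>x. x m)"
  unfolding Zhat_def by (rule residue_lim_eval_hom) auto

lemma group_hom_red: "m > 1 \<Longrightarrow> group_hom (GL2 Zhat) (GL2 (residue_ring m)) (red m)"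
  unfolding red_def by (rule ring_hom_cring.group_hom_GL2 [OF Zhat_eval_hom])

lemma red_mono:
  assumes "g \<in> carrier (GL2 Zhat)" "m > 1" "n > 1" "m dvd n" "red n g = mat_mod n x"
  shows "red m g = mat_mod m x"
proof -
  obtain a b c d where g: "g = (a, b, c, d)" by (cases g)
  obtain a' b' c' d' where x: "x = (a', b', c', d')" by (cases x)
  have "a \<in> carrier Zhat" "b \<in> carrier Zhat" "c \<in> carrier Zhat" "d \<in> carrier Zhat"
    using assms(1) cring.carrier_GL2_iff [OF cring_Zhat] by (auto simp: g carrier_M2)
  then have "a m = a n mod m" "b m = b n mod m" "c m = c n mod m" "d m = d n mod m"
    using assms by (auto simp: Zhat_carrier_iff)
  then show ?thesis
    using assms by (auto simp: g x red_def mat_mod_def map_mat2_def mod_mod_cancel)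
qed

lemma det2_Zhat_red:
  assumes "g \<in> carrier (GL2 Zhat)" "m > 1"
  shows "det2 Zhat g m = det2 (residue_ring m) (red m g)"
  using assms ring_hom_cring.det2_map_mat2 [OF Zhat_eval_hom] cring.carrier_GL2_iff [OF cring_Zhat]
  by (simp add: red_def)

text \<open>A prime \<open>p\<close> dividing both \<open>x m\<close> and \<open>m\<close> also
  divides \<open>x p\<close>, because \<open>x p = x m mod p\<close>. Testing at primes suits glued
  elements, whose components there are explicit.\<close>

lemma Units_Zhat_iff:
  "x \<in> Units Zhat \<longleftrightarrow> x \<in> carrier Zhat \<and> (\<forall>p. prime p \<longrightarrow> \<not> p dvd x p)"
proof -
  have "x \<in> Units Zhat \<longleftrightarrow> x \<in> carrier Zhat \<and> (\<forall>m>1. coprime (x m) m)"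
    unfolding Zhat_def by (subst Units_residue_lim_iff) auto
  moreover have "(\<forall>m>1. coprime (x m) m) \<longleftrightarrow> (\<forall>p. prime p \<longrightarrow> \<not> p dvd x p)"
    if x: "x \<in> carrier Zhat"
  proof (intro iffI allI impI notI)
    fix p :: int
    assume "\<forall>m>1. coprime (x m) m" "prime p" "p dvd x p"
    then have "is_unit p"
      using prime_gt_1_int [of p] coprime_common_divisor [of "x p" p p] by simp
    then show False
      using \<open>prime p\<close> not_prime_unit by blast
  next
    fix m :: int
    assume *: "\<forall>p. prime p \<longrightarrow> \<not> p dvd x p" "m > 1"
    show "coprime (x m) m"
    proof (rule ccontr)
      assume "\<not> coprime (x m) m"
      then obtain p where p: "prime p" "p dvd x m" "p dvd m"
        using prime_divisor_exists [of "gcd (x m) m"] \<open>m > 1\<close>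
        by (auto simp: coprime_iff_gcd_eq_1)
      then have "x p = x m mod p"
        using x \<open>m > 1\<close> prime_gt_1_int [of p] by (metis Zhat_carrier_iff)
      with p have "p dvd x p" by (simp add: mod_eq_0_iff_dvd)
      with * p show False by blast
    qed
  qed
  ultimately show ?thesis by blast
qed

lemma GL2_Zhat_iff:
  "(a, b, c, d) \<in> carrier (GL2 Zhat) \<longleftrightarrow>
    a \<in> carrier Zhat \<and> b \<in> carrier Zhat \<and> c \<in> carrier Zhat \<and> d \<in> carrier Zhat \<and>
    (\<forall>p. prime p \<longrightarrow> \<not> p dvd a p * d p - b p * c p)"
proof -
  interpret cring Zhat by (rule cring_Zhat)
  have "det2 Zhat (a, b, c, d) p = (a p * d p - b p * c p) mod p"
    if "(a, b, c, d) \<in> carrier (M2 Zhat)" "prime p" for p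
  proof -
    have p: "p > 1" using that prime_gt_1_int by blast
    have "mat_mod p (a p, b p, c p, d p) = red p (a, b, c, d)"
      using that p by (auto simp: mat_mod_def red_def map_mat2_def carrier_M2 Zhat_carrier_iff)
    then show ?thesis
      using ring_hom_cring.det2_map_mat2 [OF Zhat_eval_hom [OF p] that(1)] p
      by (metis det2_mat_mod red_def)
  qed
  then show ?thesis
    using det2_closed by (auto simp: carrier_GL2_iff Units_Zhat_iff carrier_M2 dvd_mod_iff)
qed

text \<open>In terms of \<open>Zhat \<simeq> (\<Prod>l. Zadic l)\<close>, the element with component \<open>x\<close> at \<open>l\<close> and \<open>c\<close> elsewhere.\<close>

lemma Zhat_glue:
  assumes l: "prime l" and x: "x \<in> carrier (Zadic l)"
  obtains y where "y \<in> carrier Zhat" "restrict y (prime_powers l) = x"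
    "\<And>m. m > 1 \<Longrightarrow> \<not> int l dvd m \<Longrightarrow> y m = c mod m"
proof -
  \<comment> \<open>Each modulus is split into its \<open>l\<close>-part and the part prime to
    \<open>l\<close>.\<close>
  define q where "q n = int l ^ multiplicity (int l) n" for n
  define r where "r n = n div q n" for n
  have l': "prime (int l)" using l by simp
  have qr: "n = q n * r n" "coprime (q n) (r n)" if "n > 1" for n
  proof -
    have "q n dvd n" by (simp add: q_def multiplicity_dvd)
    then show "n = q n * r n" by (simp add: r_def)
    have "\<not> int l dvd r n"
      unfolding r_def q_def using that l' by (intro multiplicity_decompose) auto
    then show "coprime (q n) (r n)"
      using l' by (simp add: q_def prime_imp_coprime)
  qed
  have q_pp: "q n \<in> prime_powers l" if "q n \<noteq> 1" for n
  proof -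
    have "multiplicity (int l) n \<ge> 1"
      using that by (cases "multiplicity (int l) n") (auto simp: q_def)
    then show ?thesis by (auto simp: q_def prime_powers_def)
  qed
  have x_compat: "x n mod m = x m" if "m \<in> prime_powers l" "n \<in> prime_powers l" "m dvd n" for m n
    using x that by (simp add: Zadic_def residue_lim_carrier_iff)
  \<comment> \<open>If \<open>l\<close> does not divide \<open>n\<close>, then
    \<open>q n = 1\<close> lies outside the index set of \<open>x\<close> and \<open>x (q n)\<close>
    is a default value, but a congruence modulo 1 says nothing.\<close>
  have "\<forall>n. \<exists>y. n > 1 \<longrightarrow> [y = x (q n)] (mod q n) \<and> [y = c] (mod r n)"
    using qr(2) binary_chinese_remainder_int by metis
  then obtain f where f: "\<And>n. n > 1 \<Longrightarrow> [f n = x (q n)] (mod q n)" "\<And>n. n > 1 \<Longrightarrow> [f n = c] (mod r n)"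
    by metis
  have f_compat: "[f n = f m] (mod m)" if "m > 1" "n > 1" "m dvd n" for m n
  proof -
    have "q m dvd q n"
      unfolding q_def using that dvd_imp_multiplicity_le [OF \<open>m dvd n\<close>] by (intro le_imp_power_dvd) auto
    have "r m dvd n" using qr(1) that by (metis dvd_trans dvd_triv_right)
    moreover have "coprime (r m) (q n)"
    proof -
      have "\<not> int l dvd r m"
        unfolding r_def q_def using that l' by (intro multiplicity_decompose) auto
      then show ?thesis
        using l' by (simp add: q_def prime_imp_coprime coprime_commute)
    qed
    ultimately have "r m dvd r n"
      using qr(1) [OF \<open>n > 1\<close>] coprime_dvd_mult_right_iff by metis
    \<comment> \<open>Compatibility is checked modulo the coprime factors \<open>q m\<close> and
      \<open>r m\<close> of \<open>m\<close>.\<close>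
    have "[f n = f m] (mod q m)"
    proof (cases "q m = 1")
      case False
      then have "q n \<noteq> 1" using \<open>q m dvd q n\<close>
        by (metis q_def abs_of_nonneg of_nat_0_le_iff zdvd1_eq zero_le_power)
      have "[f n = x (q n)] (mod q m)"
        using f(1) [OF \<open>n > 1\<close>] \<open>q m dvd q n\<close> cong_dvd_modulus by blast
      also have "[x (q n) = x (q m)] (mod q m)"
        using x_compat [OF q_pp [OF False] q_pp [OF \<open>q n \<noteq> 1\<close>] \<open>q m dvd q n\<close>]
        by (metis cong_def mod_mod_trivial)
      also have "[x (q m) = f m] (mod q m)"
        using f(1) [OF \<open>m > 1\<close>] by (rule cong_sym)
      finally show ?thesis .
    qed simp
    moreover have "[f n = f m] (mod r m)"
      using f(2) [OF \<open>n > 1\<close>] f(2) [OF \<open>m > 1\<close>] \<open>r m dvd r n\<close>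
      by (meson cong_dvd_modulus cong_sym cong_trans)
    ultimately show ?thesis
      using qr [OF \<open>m > 1\<close>] coprime_cong_mult by metis
  qed
  show thesis
  proof
    show "residue_family {m. m > 1} f \<in> carrier Zhat"
      unfolding Zhat_def using f_compat by (intro residue_family_closed) auto
    show "restrict (residue_family {m. m > 1} f) (prime_powers l) = x"
    proof (rule extensionalityI [of _ "prime_powers l"])
      fix m assume m: "m \<in> prime_powers l"
      then obtain k where k: "k \<ge> 1" "m = int l ^ k" by (auto simp: prime_powers_def)
      have "m > 1" using prime_powers_subset [OF l] m by auto
      have "multiplicity (int l) m = k"
        using prime_gt_1_nat [OF l] k by (simp add: multiplicity_same_power')
      then have "q m = m" by (simp add: q_def k)
      then have "f m mod m = x m mod m"
        using f(1) [OF \<open>m > 1\<close>] by (simp add: cong_def)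
      also have "\<dots> = x m" using x_compat [OF m m] by simp
      finally show "restrict (residue_family {m. m > 1} f) (prime_powers l) m = x m"
        using m \<open>m > 1\<close> by (simp add: residue_family_def)
    qed (use x in \<open>auto simp: Zadic_def residue_lim_carrier_iff\<close>)
    show "residue_family {m. m > 1} f m = c mod m" if "m > 1" "\<not> int l dvd m" for m
    proof -
      have "q m = 1" using that by (simp add: q_def not_dvd_imp_multiplicity_0)
      then have "r m = m" by (simp add: r_def)
      then show ?thesis
        using f(2) [OF \<open>m > 1\<close>] \<open>m > 1\<close> by (simp add: residue_family_def cong_def)
    qed
  qed
qed

section \<open>The sign character\<close>

text \<open>Elements of order 2 in \<open>GL2\<close> over the field with 2 elements are the non-identity matrices of trace 0.\<close>

lemma sgn_GL2_eq:
  assumes "red 2 g = mat_mod 2 (a, b, c, d)" "odd (a * d - b * c)"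
  shows "sgn_GL2 g = (if even (a + d) \<and> (odd b \<or> odd c) then - 1 else 1)"
proof -
  define S :: "(int \<times> int) set" where "S = {(0, 1), (1, 0), (1, 1)}"
  define f :: "int \<times> int \<Rightarrow> int \<times> int"
    where "f = (\<lambda>(u, v). ((a * u + b * v) mod 2, (c * u + d * v) mod 2))"
  have "carrier (residue_ring 2) \<times> carrier (residue_ring 2) - {(0, 0)} = S"
    by (auto simp: residue_ring_ops S_def)
  then have sgn: "sgn_GL2 g = sign_on S f"
    using assms(1)
    by (simp add: sgn_GL2_def red_def mat_mod_def map_mat2_mat2 mat2_act_def residue_ring_ops
        Let_def f_def mod_simps)
  let ?t = "Transposition.transpose :: int \<times> int \<Rightarrow> _"
  have transp: "sign_on S (?t x y) = - 1" "bij_betw (?t x y) S S" if "x \<in> S" "y \<in> S" "x \<noteq> y" for x y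
    using that by (auto simp: sign_on_transpose permutes_imp_bij permutes_swap_id)
  have cyc: "sign_on S (?t x y \<circ> ?t y z) = 1" if "x \<in> S" "y \<in> S" "z \<in> S" "x \<noteq> y" "y \<noteq> z" for x y z
    using that transp by (subst sign_on_compose) (auto simp: S_def)
  have fS: "sign_on S f = sign_on S h" if "\<And>x. x \<in> S \<Longrightarrow> f x = h x" for h
    using that by (rule sign_on_cong [OF refl])
  have par: "x mod 2 = (if even x then 0 else 1)" for x :: int
    by (simp add: odd_iff_mod_2_eq_one)
  \<comment> \<open>The six invertible matrices modulo 2: the identity, three transpositions and two
    3-cycles, the latter written as products of two transpositions.\<close>
  consider "odd a" "even b" "even c" "odd d" | "even a" "odd b" "odd c" "even d"
    | "odd a" "odd b" "even c" "odd d" | "odd a" "even b" "odd c" "odd d"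
    | "odd a" "odd b" "odd c" "even d" | "even a" "odd b" "odd c" "odd d"
    using assms(2) by (cases "even a"; cases "even b"; cases "even c"; cases "even d"; simp)
  then show ?thesis
  proof cases
    case 1
    then show ?thesis
      unfolding sgn by (subst fS [of "\<lambda>x. x"]) (auto simp: S_def f_def par)
  next
    case 2
    then show ?thesis
      unfolding sgn
      by (subst fS [of "?t (0, 1) (1, 0)"])
        (auto simp: S_def f_def par transpose_def transp [unfolded S_def])
  next
    case 3
    then show ?thesis
      unfolding sgn
      by (subst fS [of "?t (0, 1) (1, 1)"])
        (auto simp: S_def f_def par transpose_def transp [unfolded S_def])
  next
    case 4
    then show ?thesis
      unfolding sgn
      by (subst fS [of "?t (1, 0) (1, 1)"])
        (auto simp: S_def f_def par transpose_def transp [unfolded S_def])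
  next
    case 5
    then have "sgn_GL2 g = sign_on S (?t (1, 0) (1, 1) \<circ> ?t (1, 1) (0, 1))"
      unfolding sgn by (intro fS) (auto simp: S_def f_def par transpose_def)
    also have "\<dots> = 1" by (rule cyc) (auto simp: S_def)
    finally show ?thesis using 5 by simp
  next
    case 6
    then have "sgn_GL2 g = sign_on S (?t (0, 1) (1, 1) \<circ> ?t (1, 1) (1, 0))"
      unfolding sgn by (intro fS) (auto simp: S_def f_def par transpose_def)
    also have "\<dots> = 1" by (rule cyc) (auto simp: S_def)
    finally show ?thesis using 6 by simp
  qed
qed

lemma red_cases:
  assumes "g \<in> carrier (GL2 Zhat)" "m > 1"
  obtains a b c d where "red m g = mat_mod m (a, b, c, d)" "coprime (a * d - b * c) m"
  using group_hom.hom_closed [OF group_hom_red [OF assms(2)] assms(1)] GL2_residue_cases [OF assms(2)]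
  by metis

lemma red_2_cases:
  assumes "g \<in> carrier (GL2 Zhat)"
  obtains a b c d where "red 2 g = mat_mod 2 (a, b, c, d)" "odd (a * d - b * c)"
proof -
  have "(2 :: int) > 1" by simp
  then obtain a b c d where "red 2 g = mat_mod 2 (a, b, c, d)" "coprime (a * d - b * c) 2"
    by (rule red_cases [OF assms])
  then show thesis
    using that coprime_right_2_iff_odd by blast
qed

lemma sgn_GL2_values: "g \<in> carrier (GL2 Zhat) \<Longrightarrow> sgn_GL2 g \<in> {1, - 1}"
  using red_2_cases [of g] sgn_GL2_eq [of g] by (metis insert_iff)

text \<open>With the sign given by parities of the entries, multiplicativity is a finite
  check.\<close>

lemma sgn_GL2_mult:
  assumes "g \<in> carrier (GL2 Zhat)" "h \<in> carrier (GL2 Zhat)"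
  shows "sgn_GL2 (g \<otimes>\<^bsub>GL2 Zhat\<^esub> h) = sgn_GL2 g * sgn_GL2 h"
proof -
  obtain a b c d where g: "red 2 g = mat_mod 2 (a, b, c, d)" "odd (a * d - b * c)"
    using red_2_cases assms by blast
  obtain a' b' c' d' where h: "red 2 h = mat_mod 2 (a', b', c', d')" "odd (a' * d' - b' * c')"
    using red_2_cases assms by blast
  interpret group_hom "GL2 Zhat" "GL2 (residue_ring 2)" "red 2"
    by (rule group_hom_red) simp
  have "red 2 (g \<otimes>\<^bsub>GL2 Zhat\<^esub> h) =
      mat_mod 2 (a * a' + b * c', a * b' + b * d', c * a' + d * c', c * b' + d * d')"
    using assms g h by (simp add: mat_mod_mult)
  moreover have "odd ((a * a' + b * c') * (c * b' + d * d') - (a * b' + b * d') * (c * a' + d * c'))"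
    using g(2) h(2) by auto
  ultimately show ?thesis
    using g(2) h(2) by (auto simp: sgn_GL2_eq [OF g] sgn_GL2_eq [OF h] sgn_GL2_eq)
qed

section \<open>Goursat induction over the prime powers\<close>

text \<open>The algebraic conditions on \<open>H\<close>; closedness enters later, in
  \<open>closed_eq_GL2_Zhat\<close>.\<close>

locale full_subgroup =
  fixes H :: "(int \<Rightarrow> int) mat2 set"
  assumes subgroup: "subgroup H (GL2 Zhat)"
    and proj: "\<And>l. prime l \<Longrightarrow> proj_GL2 l ` H = carrier (GL2 (Zadic l))"
    and sgn_det: "(\<lambda>g. (sgn_GL2 g, det2 Zhat g)) ` H = {1, - 1} \<times> Units Zhat"
begin

sublocale Z: cring Zhat
  by (rule cring_Zhat)

sublocale GL: group "GL2 Zhat"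
  by (rule Z.group_GL2)

lemma H_carrier: "h \<in> H \<Longrightarrow> h \<in> carrier (GL2 Zhat)"
  by (rule subgroup.mem_carrier [OF subgroup])

lemma det_hom:
  assumes "g \<in> carrier (GL2 Zhat)" "h \<in> carrier (GL2 Zhat)"
  shows "det2 Zhat (g \<otimes>\<^bsub>GL2 Zhat\<^esub> h) = det2 Zhat g \<otimes>\<^bsub>Zhat\<^esub> det2 Zhat h"
  using assms by (simp add: Z.carrier_GL2_iff mult_GL2 Z.det2_mult)

text \<open>An integer matrix with determinant prime to \<open>l\<close> is invertible over
  \<open>Zadic l\<close>, where all moduli are powers of \<open>l\<close>. So every invertible
  matrix modulo \<open>l ^ k\<close> lifts to the \<open>l\<close>-adic group, and
  \<open>proj\<close> applies.\<close>

lemma red_onto_prime_power: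
  assumes l: "prime l" and k: "k \<ge> 1"
  shows "red (int l ^ k) ` H = carrier (GL2 (residue_ring (int l ^ k)))"
proof -
  define q where "q = int l ^ k"
  have qD: "q \<in> prime_powers l" using k by (auto simp: q_def prime_powers_def)
  then have "q > 1" using prime_powers_subset [OF l] by auto
  interpret group_hom "GL2 Zhat" "GL2 (residue_ring q)" "red q"
    by (rule group_hom_red) fact
  have "g \<in> red q ` H" if gq: "g \<in> carrier (GL2 (residue_ring q))" for g
  proof -
    obtain a b c d where g: "g = mat_mod q (a, b, c, d)" "coprime (a * d - b * c) q"
      using GL2_residue_cases [OF \<open>q > 1\<close> gq] by blast
    \<comment> \<open>Integers enter \<open>Zadic l\<close> as constant families.\<close>
    define K where "K x = residue_family (prime_powers l) (\<lambda>_. x)" for x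
    have K: "K x \<in> carrier (Zadic l)" for x
      unfolding K_def Zadic_def by (rule residue_family_closed [OF prime_powers_subset [OF l]]) simp
    have "(K a, K b, K c, K d) \<in> carrier (GL2 (Zadic l))"
      unfolding Zadic_def
    proof (subst carrier_GL2_residue_lim_iff [OF prime_powers_subset [OF l]], intro conjI ballI)
      show car: "(K a, K b, K c, K d) \<in> carrier (M2 (residue_lim (prime_powers l)))"
        using K by (simp add: carrier_M2 Zadic_def)
      fix m assume m: "m \<in> prime_powers l"
      then obtain j where "m = int l ^ j" by (auto simp: prime_powers_def)
      have "m > 1" using m prime_powers_subset [OF l] by auto
      have "coprime (a * d - b * c) m"
        using g(2) k by (simp add: q_def \<open>m = int l ^ j\<close>)
      moreover have "map_mat2 (\<lambda>x. x m) (K a, K b, K c, K d) = mat_mod m (a, b, c, d)"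
        using m by (simp add: map_mat2_mat2 mat_mod_def K_def residue_family_def)
      moreover have "det2 (residue_ring m) (map_mat2 (\<lambda>x. x m) (K a, K b, K c, K d)) =
          det2 (residue_lim (prime_powers l)) (K a, K b, K c, K d) m"
        using ring_hom_cring.det2_map_mat2
          [OF residue_lim_eval_hom [OF prime_powers_subset [OF l] m] car] .
      ultimately show "coprime (det2 (residue_lim (prime_powers l)) (K a, K b, K c, K d) m) m"
        using det2_mat_mod [OF \<open>m > 1\<close>] \<open>m > 1\<close> by (metis coprime_mod_left_iff not_one_less_zero)
    qed
    then obtain h where h: "h \<in> H" "proj_GL2 l h = (K a, K b, K c, K d)"
      using proj [OF l] by (metis imageE)
    obtain a' b' c' d' where h': "h = (a', b', c', d')" by (cases h)
    have "restrict x (prime_powers l) = K y \<Longrightarrow> x q = y mod q" for x y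
      using qD by (auto simp: K_def residue_family_def dest: fun_cong [of _ _ q])
    then have "red q h = g"
      using h(2) by (simp add: h' g red_def map_mat2_mat2 proj_GL2_def mat_mod_def)
    then show ?thesis using h(1) by blast
  qed
  then show ?thesis
    using hom_closed H_carrier unfolding q_def by blast
qed

text \<open>Commutators in \<open>H\<close> have trivial sign and determinant, and \<open>SL2\<close> is perfect modulo an odd number.\<close>

lemma SL2_lift:
  assumes m: "m > 1" "odd m" and onto: "red m ` H = carrier (GL2 (residue_ring m))"
    and g: "g \<in> carrier (GL2 (residue_ring m))" "det2 (residue_ring m) g = 1"
  obtains c where "c \<in> H" "red m c = g" "det2 Zhat c = \<one>\<^bsub>Zhat\<^esub>" "sgn_GL2 c = 1"
proof -
  let ?G = "GL2 (residue_ring m)"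
  interpret group_hom "GL2 Zhat" ?G "red m"
    by (rule group_hom_red) fact
  interpret sub: subgroup H "GL2 Zhat" by (rule subgroup)
  \<comment> \<open>The elements of \<open>H\<close> with trivial sign and determinant form a
    subgroup, so its image only has to contain the elementary matrices.\<close>
  define K where "K = {c \<in> H. det2 Zhat c = \<one>\<^bsub>Zhat\<^esub> \<and> sgn_GL2 c = 1}"
  have sgn1: "sgn_GL2 \<one>\<^bsub>GL2 Zhat\<^esub> = 1"
    using sgn_GL2_mult [of "\<one>\<^bsub>GL2 Zhat\<^esub>" "\<one>\<^bsub>GL2 Zhat\<^esub>"] sgn_GL2_values [of "\<one>\<^bsub>GL2 Zhat\<^esub>"] by auto
  have det1: "det2 Zhat \<one>\<^bsub>GL2 Zhat\<^esub> = \<one>\<^bsub>Zhat\<^esub>"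
    by (simp add: one_GL2 Z.det2_one)
  have K: "subgroup K (GL2 Zhat)"
  proof (rule GL.subgroupI)
    show "K \<subseteq> carrier (GL2 Zhat)" using H_carrier by (auto simp: K_def)
    have "\<one>\<^bsub>GL2 Zhat\<^esub> \<in> K"
      using sgn1 det1 sub.one_closed by (simp add: K_def)
    then show "K \<noteq> {}" by blast
    fix x assume x: "x \<in> K"
    then have xG: "x \<in> carrier (GL2 Zhat)" using H_carrier by (auto simp: K_def)
    have "det2 Zhat (inv\<^bsub>GL2 Zhat\<^esub> x) = \<one>\<^bsub>Zhat\<^esub>"
    proof -
      have "det2 Zhat (inv\<^bsub>GL2 Zhat\<^esub> x) \<in> carrier Zhat"
        using xG GL.inv_closed Z.carrier_GL2_iff Z.det2_closed by blast
      moreover have "det2 Zhat x \<otimes>\<^bsub>Zhat\<^esub> det2 Zhat (inv\<^bsub>GL2 Zhat\<^esub> x) = \<one>\<^bsub>Zhat\<^esub>"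
        using det_hom [of x "inv\<^bsub>GL2 Zhat\<^esub> x"] xG det1 by simp
      moreover have "det2 Zhat x = \<one>\<^bsub>Zhat\<^esub>"
        using x by (simp add: K_def)
      ultimately show ?thesis by simp
    qed
    moreover have "sgn_GL2 (inv\<^bsub>GL2 Zhat\<^esub> x) = 1"
      using sgn_GL2_mult [of x "inv\<^bsub>GL2 Zhat\<^esub> x"] x xG sgn1 by (simp add: K_def)
    ultimately show "inv\<^bsub>GL2 Zhat\<^esub> x \<in> K"
      using x by (simp add: K_def)
    fix y assume y: "y \<in> K"
    then have "y \<in> carrier (GL2 Zhat)" using H_carrier by (auto simp: K_def)
    then show "x \<otimes>\<^bsub>GL2 Zhat\<^esub> y \<in> K"
      using x y xG by (simp add: K_def det_hom sgn_GL2_mult)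
  qed
  have comm: "e \<in> red m ` K"
    if e: "e \<in> carrier ?G"
      and xy: "x \<in> carrier ?G" "y \<in> carrier ?G" "x \<otimes>\<^bsub>?G\<^esub> y = e \<otimes>\<^bsub>?G\<^esub> (y \<otimes>\<^bsub>?G\<^esub> x)" for e x y
  proof -
    obtain x' y' where xy': "x' \<in> H" "y' \<in> H" "x = red m x'" "y = red m y'"
      using xy(1,2) onto by (metis imageE)
    note car = H_carrier [OF xy'(1)] H_carrier [OF xy'(2)]
    \<comment> \<open>The commutator of lifts to \<open>H\<close>. Sign, determinant and reduction
      are applied in turn to the inverse-free relation \<open>eq\<close>.\<close>
    define c where "c = (x' \<otimes>\<^bsub>GL2 Zhat\<^esub> y') \<otimes>\<^bsub>GL2 Zhat\<^esub> inv\<^bsub>GL2 Zhat\<^esub> (y' \<otimes>\<^bsub>GL2 Zhat\<^esub> x')"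
    have c: "c \<in> H" "c \<in> carrier (GL2 Zhat)"
      using xy' car by (simp_all add: c_def)
    have eq: "c \<otimes>\<^bsub>GL2 Zhat\<^esub> (y' \<otimes>\<^bsub>GL2 Zhat\<^esub> x') = x' \<otimes>\<^bsub>GL2 Zhat\<^esub> y'"
      using car by (simp add: c_def GL.m_assoc)
    have "sgn_GL2 c * (sgn_GL2 y' * sgn_GL2 x') = sgn_GL2 x' * sgn_GL2 y'"
      using arg_cong [OF eq, of sgn_GL2] car c by (simp add: sgn_GL2_mult)
    then have "sgn_GL2 c = 1"
      using sgn_GL2_values [OF car(1)] sgn_GL2_values [OF car(2)] by auto
    have units: "det2 Zhat x' \<in> Units Zhat" "det2 Zhat y' \<in> Units Zhat" "det2 Zhat c \<in> Units Zhat"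
      using car c by (simp_all add: Z.carrier_GL2_iff)
    have "det2 Zhat c \<otimes>\<^bsub>Zhat\<^esub> (det2 Zhat y' \<otimes>\<^bsub>Zhat\<^esub> det2 Zhat x') =
        det2 Zhat x' \<otimes>\<^bsub>Zhat\<^esub> det2 Zhat y'"
      using arg_cong [OF eq, of "det2 Zhat"] car c by (simp add: det_hom)
    then have "(det2 Zhat x' \<otimes>\<^bsub>Zhat\<^esub> det2 Zhat y') \<otimes>\<^bsub>Zhat\<^esub> det2 Zhat c =
        (det2 Zhat x' \<otimes>\<^bsub>Zhat\<^esub> det2 Zhat y') \<otimes>\<^bsub>Zhat\<^esub> \<one>\<^bsub>Zhat\<^esub>"
      using units Z.Units_closed by (simp add: Z.m_comm)
    then have "det2 Zhat c = \<one>\<^bsub>Zhat\<^esub>"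
      using units Z.Units_closed by (subst (asm) Z.Units_l_cancel) simp_all
    moreover have "red m c = e"
    proof -
      have "red m c \<otimes>\<^bsub>?G\<^esub> (y \<otimes>\<^bsub>?G\<^esub> x) = e \<otimes>\<^bsub>?G\<^esub> (y \<otimes>\<^bsub>?G\<^esub> x)"
        using arg_cong [OF eq, of "red m"] car c xy xy' by simp
      then show ?thesis using xy e c by simp
    qed
    ultimately show ?thesis
      using c \<open>sgn_GL2 c = 1\<close> by (auto simp: K_def)
  qed
  have "g \<in> red m ` K"
  proof (rule elementary_imp_SL2 [OF m(1) _ _ _ g])
    show "subgroup (red m ` K) ?G"
      by (rule subgroup_img_is_subgroup [OF K])
    show "elem_up m x \<in> red m ` K" for x
      using elementary_commutator(1) [OF m, of x] comm [OF elem_closed(1) [OF m(1), of x]] by blast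
    show "elem_lo m x \<in> red m ` K" for x
      using elementary_commutator(2) [OF m, of x] comm [OF elem_closed(2) [OF m(1), of x]] by blast
  qed
  then show thesis
    using that by (auto simp: K_def)
qed

text \<open>Let \<open>U\<close> be the unit of \<open>Zhat\<close> equal to \<open>u\<close> at
  \<open>l\<close> and to 1 at all other primes. Condition (ii) gives \<open>h\<close> in
  \<open>H\<close> with determinant \<open>U\<close> and sign \<open>s\<close>. Its reduction modulo
  \<open>m\<close> has determinant 1, so \<open>SL2_lift\<close> gives \<open>c\<close> with this
  reduction and trivial sign and determinant; then \<open>v\<close> is \<open>h\<close> divided by
  \<open>c\<close>.\<close>

lemma coprime_sgn_det_in_kernel:
  assumes m: "m > 1" "odd m" and onto: "red m ` H = carrier (GL2 (residue_ring m))"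
    and l: "prime l" "\<not> int l dvd m" and k: "k \<ge> 1"
    and u: "coprime u (int l ^ k)" and s: "s \<in> {1, - 1}"
  obtains v where "v \<in> H" "red m v = \<one>\<^bsub>GL2 (residue_ring m)\<^esub>"
    "det2 (residue_ring (int l ^ k)) (red (int l ^ k) v) = u mod int l ^ k" "sgn_GL2 v = s"
proof -
  let ?q = "int l ^ k"
  have lq: "int l > 1" using prime_gt_1_nat [OF l(1)] by simp
  then have q: "?q > 1" "?q \<in> prime_powers l" using k by (auto simp: prime_powers_def)
  have l_u: "\<not> int l dvd u" using u coprime_prime_power_iff [OF l(1) k] by blast
  define x where "x = residue_family (prime_powers l) (\<lambda>_. u)"
  have "x \<in> carrier (Zadic l)"
    unfolding x_def Zadic_def by (rule residue_family_closed [OF prime_powers_subset [OF l(1)]]) simp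
  then obtain U where U: "U \<in> carrier Zhat" "restrict U (prime_powers l) = x"
    "\<And>n. n > 1 \<Longrightarrow> \<not> int l dvd n \<Longrightarrow> U n = 1 mod n"
    using Zhat_glue [OF l(1), of x 1] by metis
  have U_pp: "U n = u mod n" if "n \<in> prime_powers l" for n
    using that fun_cong [OF U(2), of n] by (simp add: x_def residue_family_def)
  have "\<not> p dvd U p" if p: "prime p" for p
  proof (cases "p = int l")
    case True
    have "int l \<in> prime_powers l" by (auto simp: prime_powers_def intro: exI [of _ 1])
    then show ?thesis using True U_pp l_u by (simp add: dvd_mod_iff)
  next
    case False
    have "p > 1" using p prime_gt_1_int by blast
    have "\<not> int l dvd p"
      using False p l(1) primes_dvd_imp_eq [of "int l" p] by auto
    then have "U p = 1" using U(3) \<open>p > 1\<close> by simp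
    then show ?thesis using p not_prime_unit by auto
  qed
  then have "U \<in> Units Zhat" using U(1) by (simp add: Units_Zhat_iff)
  then have "(s, U) \<in> (\<lambda>g. (sgn_GL2 g, det2 Zhat g)) ` H"
    using sgn_det s by blast
  then obtain h where h: "h \<in> H" "sgn_GL2 h = s" "det2 Zhat h = U" by blast
  have "det2 (residue_ring m) (red m h) = 1"
    using det2_Zhat_red [OF H_carrier [OF h(1)] m(1)] h(3) U(3) [OF m(1) l(2)] m(1) by simp
  moreover have "red m h \<in> carrier (GL2 (residue_ring m))"
    using onto h(1) by blast
  ultimately obtain c where c: "c \<in> H" "red m c = red m h" "det2 Zhat c = \<one>\<^bsub>Zhat\<^esub>" "sgn_GL2 c = 1"
    using SL2_lift [OF m onto] by metis
  interpret sub: subgroup H "GL2 Zhat" by (rule subgroup)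
  interpret group_hom "GL2 Zhat" "GL2 (residue_ring m)" "red m"
    by (rule group_hom_red [OF m(1)])
  define v where "v = h \<otimes>\<^bsub>GL2 Zhat\<^esub> inv\<^bsub>GL2 Zhat\<^esub> c"
  have car: "h \<in> carrier (GL2 Zhat)" "c \<in> carrier (GL2 Zhat)"
    using h(1) c(1) H_carrier by blast+
  have v: "v \<in> H" "v \<in> carrier (GL2 Zhat)" "v \<otimes>\<^bsub>GL2 Zhat\<^esub> c = h"
    using h(1) c(1) car by (simp_all add: v_def GL.m_assoc)
  have "det2 Zhat v \<in> carrier Zhat"
    using v(2) Z.carrier_GL2_iff Z.det2_closed by blast
  moreover have "det2 Zhat v \<otimes>\<^bsub>Zhat\<^esub> det2 Zhat c = U"
    using det_hom [OF v(2) car(2)] v(3) h(3) by simp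
  ultimately have "det2 Zhat v = U" using c(3) by simp
  show thesis
  proof
    show "v \<in> H" by fact
    show "red m v = \<one>\<^bsub>GL2 (residue_ring m)\<^esub>"
      using car c(2) by (simp add: v_def)
    show "det2 (residue_ring ?q) (red ?q v) = u mod ?q"
      using det2_Zhat_red [OF v(2) q(1)] \<open>det2 Zhat v = U\<close> U_pp q(2) by simp
    show "sgn_GL2 v = s"
      using sgn_GL2_mult [OF v(2) car(2)] v(3) h(2) c(4) by simp
  qed
qed

text \<open>The Goursat step. The kernel \<open>K\<close> of reduction modulo \<open>m\<close> on
  \<open>H\<close> is normal in \<open>H\<close>, and \<open>H\<close> maps onto \<open>GL2\<close>
  modulo \<open>q\<close>, so the image of \<open>K\<close> there is normal. By
  \<open>normal_eq_GL2\<close> it is everything.\<close>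

lemma red_onto_mult:
  assumes m: "m > 1" "odd m" and onto: "red m ` H = carrier (GL2 (residue_ring m))"
    and l: "prime l" "\<not> int l dvd m" and k: "k \<ge> 1"
  shows "red (m * int l ^ k) ` H = carrier (GL2 (residue_ring (m * int l ^ k)))"
proof -
  define q where "q = int l ^ k"
  have "int l > 1" using prime_gt_1_nat [OF l(1)] by simp
  then have q: "q > 1" using k by (simp add: q_def)
  have mq: "m * q > 1" using m(1) q less_1_mult by blast
  have cop: "coprime m q"
    using coprime_prime_power_iff [OF l(1) k] l(2) by (simp add: q_def)
  interpret sub: subgroup H "GL2 Zhat" by (rule subgroup)
  interpret M: group_hom "GL2 Zhat" "GL2 (residue_ring m)" "red m"
    by (rule group_hom_red [OF m(1)])
  interpret Q: group_hom "GL2 Zhat" "GL2 (residue_ring q)" "red q"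
    by (rule group_hom_red [OF q])
  interpret MQ: group_hom "GL2 Zhat" "GL2 (residue_ring (m * q))" "red (m * q)"
    by (rule group_hom_red [OF mq])
  have onto_q: "red q ` H = carrier (GL2 (residue_ring q))"
    unfolding q_def by (rule red_onto_prime_power [OF l(1) k])
  define K where "K = {h \<in> H. red m h = \<one>\<^bsub>GL2 (residue_ring m)\<^esub>}"
  have K_car: "h \<in> K \<Longrightarrow> h \<in> carrier (GL2 Zhat)" for h
    using H_carrier by (simp add: K_def)
  have K: "subgroup K (GL2 Zhat)"
  proof (rule GL.subgroupI)
    show "K \<subseteq> carrier (GL2 Zhat)" using K_car by blast
    have "\<one>\<^bsub>GL2 Zhat\<^esub> \<in> K" by (simp add: K_def)
    then show "K \<noteq> {}" by blast
  qed (use K_car in \<open>simp_all add: K_def\<close>)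
  have conj_K: "h \<otimes>\<^bsub>GL2 Zhat\<^esub> v \<otimes>\<^bsub>GL2 Zhat\<^esub> inv\<^bsub>GL2 Zhat\<^esub> h \<in> K" if "h \<in> H" "v \<in> K" for h v
    using that H_carrier [OF that(1)] K_car [OF that(2)] by (simp add: K_def)
  have N: "red q ` K \<lhd> GL2 (residue_ring q)"
    unfolding Q.H.normal_inv_iff
  proof (intro conjI ballI)
    show "subgroup (red q ` K) (GL2 (residue_ring q))"
      by (rule Q.subgroup_img_is_subgroup [OF K])
    fix x y assume "x \<in> carrier (GL2 (residue_ring q))" "y \<in> red q ` K"
    then obtain h v where hv: "h \<in> H" "x = red q h" "v \<in> K" "y = red q v"
      using onto_q by (metis imageE)
    then have "x \<otimes>\<^bsub>GL2 (residue_ring q)\<^esub> y \<otimes>\<^bsub>GL2 (residue_ring q)\<^esub> inv\<^bsub>GL2 (residue_ring q)\<^esub> x =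
        red q (h \<otimes>\<^bsub>GL2 Zhat\<^esub> v \<otimes>\<^bsub>GL2 Zhat\<^esub> inv\<^bsub>GL2 Zhat\<^esub> h)"
      using H_carrier [OF hv(1)] K_car [OF hv(3)] by simp
    then show "x \<otimes>\<^bsub>GL2 (residue_ring q)\<^esub> y \<otimes>\<^bsub>GL2 (residue_ring q)\<^esub> inv\<^bsub>GL2 (residue_ring q)\<^esub> x \<in> red q ` K"
      using conj_K [OF hv(1,3)] by blast
  qed
  have N_eq: "red q ` K = carrier (GL2 (residue_ring q))"
  proof (rule normal_eq_GL2 [OF l(1) k q_def N])
    fix u assume "coprime u q"
    then obtain v where v: "v \<in> H" "red m v = \<one>\<^bsub>GL2 (residue_ring m)\<^esub>"
      "det2 (residue_ring q) (red q v) = u mod q"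
      using coprime_sgn_det_in_kernel [OF m onto l k, of u 1] unfolding q_def by blast
    then have "v \<in> K" by (simp add: K_def)
    with v(3) show "\<exists>n\<in>red q ` K. det2 (residue_ring q) n = u mod q" by blast
  next
    assume "l = 2"
    then have "2 dvd q" using k by (simp add: q_def)
    have "coprime 1 (int l ^ k)" "(- 1 :: int) \<in> {1, - 1}" by simp_all
    then obtain v where v: "v \<in> H" "red m v = \<one>\<^bsub>GL2 (residue_ring m)\<^esub>"
      "det2 (residue_ring q) (red q v) = 1 mod q" "sgn_GL2 v = - 1"
      unfolding q_def by (rule coprime_sgn_det_in_kernel [OF m onto l k])
    obtain p b r s where prs: "red q v = mat_mod q (p, b, r, s)"
      using red_cases [OF H_carrier [OF v(1)] q] by metis
    have det: "q dvd p * s - b * r - 1"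
      using v(3) by (simp add: prs det2_mat_mod [OF q] mod_eq_dvd_iff)
    \<comment> \<open>The sign only depends on the reduction modulo 2, which can be read off from
      the one modulo \<open>q\<close>.\<close>
    have "red 2 v = mat_mod 2 (p, b, r, s)"
      using red_mono [OF H_carrier [OF v(1)] _ q \<open>2 dvd q\<close> prs] by simp
    moreover have "2 dvd p * s - b * r - 1"
      using det \<open>2 dvd q\<close> dvd_trans by blast
    then have "odd (p * s - b * r)" by presburger
    ultimately have "even (p + s) \<and> (odd b \<or> odd r)"
      using sgn_GL2_eq [of v p b r s] v(4) by (simp split: if_splits)
    then show "\<exists>p b r s. mat_mod q (p, b, r, s) \<in> red q ` K \<and> q dvd p * s - b * r - 1 \<and>
        even (p + s) \<and> (odd b \<or> odd r)"
      using det prs v(1,2) by (auto simp: K_def simp flip: prs intro!: exI)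
  qed
  have "g \<in> red (m * q) ` H" if g: "g \<in> carrier (GL2 (residue_ring (m * q)))" for g
  proof -
    obtain a b c d where abcd: "g = mat_mod (m * q) (a, b, c, d)" "coprime (a * d - b * c) (m * q)"
      using GL2_residue_cases [OF mq g] by blast
    have gm: "mat_mod m (a, b, c, d) \<in> carrier (GL2 (residue_ring m))"
      and gq: "mat_mod q (a, b, c, d) \<in> carrier (GL2 (residue_ring q))"
      using abcd(2) by (simp_all add: mat_mod_in_carrier_iff m(1) q)
    \<comment> \<open>\<open>h\<close> is right modulo \<open>m\<close>; an element of
      \<open>K\<close>, being trivial modulo \<open>m\<close>, then corrects it modulo
      \<open>q\<close>.\<close>
    obtain h where h: "h \<in> H" "red m h = mat_mod m (a, b, c, d)"
      using gm onto by (metis imageE)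
    have hG: "h \<in> carrier (GL2 Zhat)" using h(1) by (rule H_carrier)
    have "inv\<^bsub>GL2 (residue_ring q)\<^esub> (red q h) \<otimes>\<^bsub>GL2 (residue_ring q)\<^esub> mat_mod q (a, b, c, d) \<in> red q ` K"
      using gq hG by (simp add: N_eq)
    then obtain v where v: "v \<in> K"
      "red q v = inv\<^bsub>GL2 (residue_ring q)\<^esub> (red q h) \<otimes>\<^bsub>GL2 (residue_ring q)\<^esub> mat_mod q (a, b, c, d)"
      by (metis imageE)
    have vG: "v \<in> carrier (GL2 Zhat)" using v(1) by (rule K_car)
    define w where "w = h \<otimes>\<^bsub>GL2 Zhat\<^esub> v"
    have w: "w \<in> H" "w \<in> carrier (GL2 Zhat)"
      using h(1) v(1) hG vG by (simp_all add: w_def K_def)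
    have wm: "red m w = mat_mod m (a, b, c, d)"
      using h hG v(1) vG gm by (simp add: w_def K_def)
    have wq: "red q w = mat_mod q (a, b, c, d)"
      using hG v(2) vG gq by (simp add: w_def Q.H.m_assoc [symmetric])
    obtain a' b' c' d' where w': "red (m * q) w = mat_mod (m * q) (a', b', c', d')"
      using red_cases [OF w(2) mq] by metis
    have "red m w = mat_mod m (a', b', c', d')" "red q w = mat_mod q (a', b', c', d')"
      using red_mono [OF w(2) _ mq _ w'] m(1) q by simp_all
    then have "red (m * q) w = g"
      unfolding w' abcd(1) using wm wq cop
      by (auto simp: mat_mod_eq_iff intro!: coprime_cong_mult intro: cong_sym)
    then show ?thesis using w(1) by blast
  qed
  then show ?thesis
    using MQ.hom_closed H_carrier unfolding q_def by blast
qed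

lemma red_onto:
  assumes "m > 1"
  shows "red m ` H = carrier (GL2 (residue_ring m))"
  using assms
proof (induction "nat m" arbitrary: m rule: less_induct)
  case less
  \<comment> \<open>The prime 2 is split off first, so that the cofactor \<open>r\<close> is always
    odd, as \<open>red_onto_mult\<close> demands.\<close>
  define l where "l = (if even m then 2 else SOME l. prime l \<and> int l dvd m)"
  have l: "prime l" "int l dvd m"
  proof -
    have "\<exists>l. prime l \<and> int l dvd m"
    proof -
      obtain p where "prime p" "p dvd m"
        using prime_divisor_exists [of m] less.prems by auto
      then show ?thesis
        by (intro exI [of _ "nat p"]) (auto simp: prime_ge_0_int)
    qed
    from someI_ex [OF this] show "prime l" "int l dvd m"
      by (auto simp: l_def)
  qed
  have l1: "int l > 1" using prime_gt_1_nat [OF l(1)] by simp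
  define k where "k = multiplicity (int l) m"
  define r where "r = m div int l ^ k"
  have k: "k \<ge> 1"
    unfolding k_def using l less.prems l1 by (intro multiplicity_geI) auto
  have m_eq: "m = r * int l ^ k"
    by (simp add: r_def k_def multiplicity_dvd)
  have r: "\<not> int l dvd r"
    unfolding r_def k_def using less.prems l1 by (intro multiplicity_decompose) auto
  have "odd r"
  proof (cases "even m")
    case True
    then show ?thesis using r by (simp add: l_def)
  next
    case False
    then show ?thesis using m_eq by auto
  qed
  have "int l ^ k > 1" using l1 k by simp
  have "r > 0"
    using m_eq less.prems \<open>int l ^ k > 1\<close> by (metis less_trans zero_less_mult_pos2 zero_less_one)
  show ?case
  proof (cases "r = 1")
    case True
    then show ?thesis using red_onto_prime_power [OF l(1) k] m_eq by simp
  next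
    case False
    then have "r > 1" using \<open>r > 0\<close> by simp
    moreover have "r < m"
      using m_eq \<open>r > 0\<close> \<open>int l ^ k > 1\<close> by (metis mult.right_neutral mult_strict_left_mono)
    ultimately have "red r ` H = carrier (GL2 (residue_ring r))"
      using less.hyps [of r] by simp
    then show ?thesis
      using red_onto_mult [OF \<open>r > 1\<close> \<open>odd r\<close> _ l(1) r k] m_eq by simp
  qed
qed

end

section \<open>Density and surjectivity\<close>

lemma carrier_Zhat_subset_topspace: "carrier Zhat \<subseteq> topspace Zhat_topology"
  by (auto simp: Zhat_topology_def residue_lim_topology_def Zhat_def residue_lim_def)

text \<open>A basic open set constrains finitely many components, and all of these are determined by
  the component at a common multiple of their moduli.\<close>

lemma Zhat_neighbourhood:
  assumes "openin Zhat_topology U" "x \<in> U"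
  obtains M where "M > 1" "\<And>y. y \<in> carrier Zhat \<Longrightarrow> y M = x M \<Longrightarrow> y \<in> U"
proof -
  let ?X = "\<lambda>m. discrete_topology (carrier (residue_ring m))"
  obtain V where V: "openin (product_topology ?X {m. m > 1}) V" "U = V \<inter> carrier Zhat"
    using assms(1) by (auto simp: Zhat_topology_def residue_lim_topology_def Zhat_def openin_subtopology)
  then obtain W where W: "finite {i \<in> {m. m > 1}. W i \<noteq> topspace (?X i)}"
    "x \<in> Pi\<^sub>E {m. m > 1} W" "Pi\<^sub>E {m. m > 1} W \<subseteq> V"
    using assms(2) unfolding openin_product_topology_alt by blast
  define F where "F = {i \<in> {m. m > 1}. W i \<noteq> topspace (?X i)}"
  \<comment> \<open>The factor 2 ensures \<open>M > 1\<close> even if \<open>F\<close> is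
    empty.\<close>
  define M where "M = 2 * \<Prod>F"
  have "finite F" using W(1) by (simp add: F_def)
  have "\<Prod>F > 0" by (rule prod_pos) (auto simp: F_def)
  then have "M > 1" by (simp add: M_def)
  moreover have "y \<in> U" if y: "y \<in> carrier Zhat" "y M = x M" for y
  proof -
    have "x \<in> carrier Zhat" using assms(2) V(2) by blast
    have "y i \<in> W i" if "i > 1" for i
    proof (cases "i \<in> F")
      case True
      then have "i dvd M"
        using dvd_prodI [OF \<open>finite F\<close> True, of "\<lambda>x. x"] by (simp add: M_def)
      then have "y i = x i"
        using y \<open>x \<in> carrier Zhat\<close> \<open>M > 1\<close> \<open>i > 1\<close> by (metis Zhat_carrier_iff)
      then show ?thesis using W(2) \<open>i > 1\<close> by auto
    next
      case False
      then have "W i = carrier (residue_ring i)" using \<open>i > 1\<close> by (simp add: F_def)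
      then show ?thesis
        using y(1) \<open>i > 1\<close> by (simp add: Zhat_carrier_iff residue_ring_ops)
    qed
    then have "y \<in> Pi\<^sub>E {m. m > 1} W"
      using y(1) by (simp add: PiE_iff Zhat_carrier_iff)
    then show ?thesis using W(3) V(2) y(1) by blast
  qed
  ultimately show thesis by (rule that)
qed

text \<open>An element outside \<open>H\<close> would have a neighbourhood disjoint from
  \<open>H\<close>. That neighbourhood contains all invertible matrices with the same reduction
  modulo some \<open>M\<close>, and one of them lies in \<open>H\<close>.\<close>

lemma closed_eq_GL2_Zhat:
  assumes closed: "closedin GL2_Zhat_topology H"
    and onto: "\<And>m. m > 1 \<Longrightarrow> red m ` H = carrier (GL2 (residue_ring m))"
  shows "H = carrier (GL2 Zhat)"
proof
  let ?T = "prod_topology Zhat_topology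
        (prod_topology Zhat_topology (prod_topology Zhat_topology Zhat_topology))"
  have car: "carrier (GL2 Zhat) \<subseteq> topspace ?T"
    using carrier_Zhat_subset_topspace by (auto simp: GL2_Zhat_iff)
  then have top: "topspace GL2_Zhat_topology = carrier (GL2 Zhat)"
    by (auto simp: GL2_Zhat_topology_def)
  then show H: "H \<subseteq> carrier (GL2 Zhat)" using closedin_subset [OF closed] by simp
  show "carrier (GL2 Zhat) \<subseteq> H"
  proof (rule ccontr)
    assume "\<not> ?thesis"
    then obtain g where g: "g \<in> carrier (GL2 Zhat)" "g \<notin> H" by blast
    obtain a b c d where abcd: "g = (a, b, c, d)" by (cases g)
    have "openin GL2_Zhat_topology (carrier (GL2 Zhat) - H)"
      using closed top by (simp add: closedin_def)
    then obtain V where V: "openin ?T V" "carrier (GL2 Zhat) - H = V \<inter> carrier (GL2 Zhat)"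
      by (auto simp: GL2_Zhat_topology_def openin_subtopology)
    then have abcdV: "(a, b, c, d) \<in> V" using g abcd by blast
    note box = openin_prod_topology_alt [THEN iffD1, rule_format]
    obtain A V1 where A: "openin Zhat_topology A" "a \<in> A"
      and V1: "openin (prod_topology Zhat_topology (prod_topology Zhat_topology Zhat_topology)) V1"
        "(b, c, d) \<in> V1" "A \<times> V1 \<subseteq> V"
      using box [OF V(1) abcdV] by blast
    obtain B V2 where B: "openin Zhat_topology B" "b \<in> B"
      and V2: "openin (prod_topology Zhat_topology Zhat_topology) V2" "(c, d) \<in> V2" "B \<times> V2 \<subseteq> V1"
      using box [OF V1(1,2)] by blast
    obtain C D where C: "openin Zhat_topology C" "c \<in> C"
      and D: "openin Zhat_topology D" "d \<in> D" and CD: "C \<times> D \<subseteq> V2"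
      using box [OF V2(1,2)] by blast
    obtain Ma where Ma: "Ma > 1" "\<And>y. y \<in> carrier Zhat \<Longrightarrow> y Ma = a Ma \<Longrightarrow> y \<in> A"
      using Zhat_neighbourhood [OF A] by metis
    obtain Mb where Mb: "Mb > 1" "\<And>y. y \<in> carrier Zhat \<Longrightarrow> y Mb = b Mb \<Longrightarrow> y \<in> B"
      using Zhat_neighbourhood [OF B] by metis
    obtain Mc where Mc: "Mc > 1" "\<And>y. y \<in> carrier Zhat \<Longrightarrow> y Mc = c Mc \<Longrightarrow> y \<in> C"
      using Zhat_neighbourhood [OF C] by metis
    obtain Md where Md: "Md > 1" "\<And>y. y \<in> carrier Zhat \<Longrightarrow> y Md = d Md \<Longrightarrow> y \<in> D"
      using Zhat_neighbourhood [OF D] by metis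
    \<comment> \<open>A common multiple of the moduli for the four entries; agreement modulo
      \<open>M\<close> puts each entry of \<open>h\<close> into its factor of the box.\<close>
    define M where "M = Ma * Mb * Mc * Md"
    have "M > 1"
      unfolding M_def using Ma(1) Mb(1) Mc(1) Md(1) by (intro less_1_mult)
    then have "red M g \<in> red M ` H"
      using g onto group_hom.hom_closed [OF group_hom_red] by metis
    then obtain h where h: "h \<in> H" "red M h = red M g" by (metis imageE)
    obtain a' b' c' d' where h': "h = (a', b', c', d')" by (cases h)
    have hG: "h \<in> carrier (GL2 Zhat)" using h(1) H by blast
    have cars: "a \<in> carrier Zhat" "b \<in> carrier Zhat" "c \<in> carrier Zhat" "d \<in> carrier Zhat"
      "a' \<in> carrier Zhat" "b' \<in> carrier Zhat" "c' \<in> carrier Zhat" "d' \<in> carrier Zhat"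
      using g(1) hG by (simp_all add: abcd h' GL2_Zhat_iff)
    have eqs: "a' M = a M" "b' M = b M" "c' M = c M" "d' M = d M"
      using h(2) by (simp_all add: abcd h' red_def map_mat2_mat2)
    have restr: "x' m = x m"
      if "x \<in> carrier Zhat" "x' \<in> carrier Zhat" "x' M = x M" "m > 1" "m dvd M" for x x' m
      using that \<open>M > 1\<close> by (metis Zhat_carrier_iff)
    have "a' \<in> A" "b' \<in> B" "c' \<in> C" "d' \<in> D"
      using Ma Mb Mc Md cars eqs restr by (auto simp: M_def)
    then have "h \<in> V" using V1(3) V2(3) CD h' by blast
    then show False using V(2) h(1) hG by blast
  qed
qed

section \<open>Both conditions hold for the whole group\<close>

lemma proj_GL2_onto:
  assumes l: "prime l"
  shows "proj_GL2 l ` carrier (GL2 Zhat) = carrier (GL2 (Zadic l))"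
proof
  have "ring_hom_cring Zhat (Zadic l) (\<lambda>x. restrict x (prime_powers l))"
    unfolding Zhat_def Zadic_def
    using prime_powers_subset [OF l] by (intro residue_lim_restrict_hom) auto
  from group_hom.hom_closed [OF ring_hom_cring.group_hom_GL2 [OF this]]
  show "proj_GL2 l ` carrier (GL2 Zhat) \<subseteq> carrier (GL2 (Zadic l))"
    by (auto simp: proj_GL2_def)
  show "carrier (GL2 (Zadic l)) \<subseteq> proj_GL2 l ` carrier (GL2 Zhat)"
  proof
    fix g assume g: "g \<in> carrier (GL2 (Zadic l))"
    obtain a b c d where abcd: "g = (a, b, c, d)" by (cases g)
    note pp = prime_powers_subset [OF l]
    have "g \<in> carrier (M2 (Zadic l))"
      using g carrier_GL2_residue_lim_iff [OF pp] by (simp add: Zadic_def)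
    then have cars: "a \<in> carrier (Zadic l)" "b \<in> carrier (Zadic l)"
      "c \<in> carrier (Zadic l)" "d \<in> carrier (Zadic l)"
      by (simp_all add: abcd carrier_M2)
    \<comment> \<open>The given matrix is extended by the identity matrix at all other primes, so
      the determinant stays a unit there.\<close>
    obtain a' where a': "a' \<in> carrier Zhat" "restrict a' (prime_powers l) = a"
      "\<And>m. m > 1 \<Longrightarrow> \<not> int l dvd m \<Longrightarrow> a' m = 1 mod m"
      using Zhat_glue [OF l cars(1), of 1] by metis
    obtain b' where b': "b' \<in> carrier Zhat" "restrict b' (prime_powers l) = b"
      "\<And>m. m > 1 \<Longrightarrow> \<not> int l dvd m \<Longrightarrow> b' m = 0 mod m"
      using Zhat_glue [OF l cars(2), of 0] by metis
    obtain c' where c': "c' \<in> carrier Zhat" "restrict c' (prime_powers l) = c"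
      "\<And>m. m > 1 \<Longrightarrow> \<not> int l dvd m \<Longrightarrow> c' m = 0 mod m"
      using Zhat_glue [OF l cars(3), of 0] by metis
    obtain d' where d': "d' \<in> carrier Zhat" "restrict d' (prime_powers l) = d"
      "\<And>m. m > 1 \<Longrightarrow> \<not> int l dvd m \<Longrightarrow> d' m = 1 mod m"
      using Zhat_glue [OF l cars(4), of 1] by metis
    have "\<not> p dvd a' p * d' p - b' p * c' p" if p: "prime p" for p
    proof (cases "p = int l")
      case True
      have lpp: "int l \<in> prime_powers l" by (auto simp: prime_powers_def intro: exI [of _ 1])
      have l1: "int l > 1" using pp lpp by auto
      have "map_mat2 (\<lambda>x. x (int l)) g \<in> carrier (GL2 (residue_ring (int l)))"
        using group_hom.hom_closed [OF ring_hom_cring.group_hom_GL2 [OF residue_lim_eval_hom [OF pp lpp]]] g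
        by (simp add: Zadic_def)
      moreover have "map_mat2 (\<lambda>x. x (int l)) g =
          mat_mod (int l) (a' (int l), b' (int l), c' (int l), d' (int l))"
        using a'(1) b'(1) c'(1) d'(1) lpp l1
        by (simp add: abcd map_mat2_mat2 mat_mod_def Zhat_carrier_iff
            flip: a'(2) b'(2) c'(2) d'(2))
      ultimately have "coprime (a' (int l) * d' (int l) - b' (int l) * c' (int l)) (int l ^ 1)"
        using mat_mod_in_carrier_iff [OF l1] by simp
      then show ?thesis
        using coprime_prime_power_iff [OF l, of 1] True by blast
    next
      case False
      have "p > 1" using p prime_gt_1_int by blast
      moreover have "\<not> int l dvd p"
        using False p l primes_dvd_imp_eq [of "int l" p] by auto
      ultimately show ?thesis
        using a'(3) b'(3) c'(3) d'(3) p not_prime_unit by auto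
    qed
    then have "(a', b', c', d') \<in> carrier (GL2 Zhat)"
      using a'(1) b'(1) c'(1) d'(1) by (simp add: GL2_Zhat_iff)
    moreover have "proj_GL2 l (a', b', c', d') = g"
      by (simp add: proj_GL2_def map_mat2_mat2 abcd a'(2) b'(2) c'(2) d'(2))
    ultimately show "g \<in> proj_GL2 l ` carrier (GL2 Zhat)" by blast
  qed
qed

text \<open>The upper triangular matrix with diagonal \<open>U\<close>, 1 has determinant
  \<open>U\<close>. Since \<open>U\<close> is 1 modulo 2, its upper right entry, 0 or 1, makes its
  reduction the identity or a transposition.\<close>

lemma sgn_det_onto:
  "(\<lambda>g. (sgn_GL2 g, det2 Zhat g)) ` carrier (GL2 Zhat) = {1, - 1} \<times> Units Zhat"
proof
  interpret cring Zhat by (rule cring_Zhat)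
  show "(\<lambda>g. (sgn_GL2 g, det2 Zhat g)) ` carrier (GL2 Zhat) \<subseteq> {1, - 1} \<times> Units Zhat"
    using sgn_GL2_values carrier_GL2_iff by (auto simp: image_subset_iff)
  have E: "(s, U) \<in> (\<lambda>g. (sgn_GL2 g, det2 Zhat g)) ` carrier (GL2 Zhat)"
    if U: "U \<in> Units Zhat" and x: "x = (if s = 1 then \<zero>\<^bsub>Zhat\<^esub> else \<one>\<^bsub>Zhat\<^esub>)" and s: "s \<in> {1, - 1}"
    for s U x
  proof -
    let ?g = "(U, x, \<zero>\<^bsub>Zhat\<^esub>, \<one>\<^bsub>Zhat\<^esub>)"
    have "U \<in> carrier Zhat" "x \<in> carrier Zhat" using U x by auto
    then have det: "det2 Zhat ?g = U"
      by (simp add: det2_mat2 minus_eq)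
    have g: "?g \<in> carrier (GL2 Zhat)"
      using U \<open>x \<in> carrier Zhat\<close> det by (simp add: carrier_GL2_iff carrier_M2 Units_closed)
    have "0 \<le> U 2" "U 2 < 2" "\<not> 2 dvd U 2"
      using U \<open>U \<in> carrier Zhat\<close> by (auto simp: Units_Zhat_iff Zhat_carrier_iff)
    then have "U 2 = 1" by presburger
    then have "red 2 ?g = mat_mod 2 (1, if s = 1 then 0 else 1, 0, 1)"
      by (simp add: red_def map_mat2_mat2 mat_mod_def x)
        (simp add: Zhat_def residue_lim_ops)
    then have "sgn_GL2 ?g = s"
      using s sgn_GL2_eq [of ?g 1 "if s = 1 then 0 else 1" 0 1] by auto
    then have "(s, U) = (sgn_GL2 ?g, det2 Zhat ?g)" using det by simp
    then show ?thesis using g by (rule image_eqI)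
  qed
  then show "{1, - 1} \<times> Units Zhat \<subseteq> (\<lambda>g. (sgn_GL2 g, det2 Zhat g)) ` carrier (GL2 Zhat)"
    by (intro subrelI) blast
qed

theorem theorem1p1:
  fixes H :: "(int \<Rightarrow> int) mat2 set"
  assumes "subgroup H (GL2 Zhat)"
    and "closedin GL2_Zhat_topology H"
  shows "H = carrier (GL2 Zhat) \<longleftrightarrow>
    (\<forall>l::nat. prime l \<longrightarrow> proj_GL2 l ` H = carrier (GL2 (Zadic l))) \<and>
    (\<lambda>g. (sgn_GL2 g, det2 Zhat g)) ` H = {1, -1} \<times> Units Zhat"
proof
  assume "H = carrier (GL2 Zhat)"
  then show "(\<forall>l::nat. prime l \<longrightarrow> proj_GL2 l ` H = carrier (GL2 (Zadic l))) \<and>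
    (\<lambda>g. (sgn_GL2 g, det2 Zhat g)) ` H = {1, -1} \<times> Units Zhat"
    using proj_GL2_onto sgn_det_onto by blast
next
  assume "(\<forall>l::nat. prime l \<longrightarrow> proj_GL2 l ` H = carrier (GL2 (Zadic l))) \<and>
    (\<lambda>g. (sgn_GL2 g, det2 Zhat g)) ` H = {1, -1} \<times> Units Zhat"
  then interpret full_subgroup H
    using assms(1) by (simp add: full_subgroup_def)
  show "H = carrier (GL2 Zhat)"
    using closed_eq_GL2_Zhat [OF assms(2) red_onto] by blast
qed

end
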